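(* Suppose that $\mathcal X$ and $A$ are finite, that $\varepsilon>0$, and that the policy class $\{\pi^\theta:\theta\in\Theta\}$ is regular (see context). Fix $\theta\in\mathrm{int}(\Theta)$ and a direction $r\in\mathbb R^{d_\theta}$. For $t\in\mathcal T$ and $(x,a)\in\mathcal X\times A$ put $$H_\theta(y):=f(t,x,a,y)+V_{t+1}^\theta(y),\qquad \mathcal P_t^*(x,a,\theta):=\arg\min_{\mathbb P\in\mathbb B_t(x,a)}\sum_{y\in\mathcal X}\mathbb P(\{y\})H_\theta(y).$$ Then for every $x\in\mathcal X$ and $t\in\bar{\mathcal T}$ the one-sided directional derivatives $D_\theta^{\pm}V_t^\theta(x)[r]$ exist, with $D_\theta^{\pm}V_T^\theta(x)[r]=0$ and, for $t=T-1,\dots,0$, $$D_\theta^{\pm}V_t^\theta(x)[r]=\sum_{a\in A}\pi_t^\theta(x,a)\Big[G_t^\theta(x,a)\langle\nabla_\theta\log\pi_t^\theta(x,a),r\rangle+D_\theta^{\pm}G_t^\theta(x,a)[r]\Big],$$ where $$D_\theta^+G_t^\theta(x,a)[r]=\min_{\mathbb P^*\in\mathcal P_t^*(x,a,\theta)}\sum_{y\in\mathcal X}\mathbb P^*(\{y\})D_\theta^+V_{t+1}^\theta(y)[r],\qquad D_\theta^-G_t^\theta(x,a)[r]=\max_{\mathbb P^*\in\mathcal P_t^*(x,a,\theta)}\sum_{y\in\mathcal X}\mathbb P^*(\{y\})D_\theta^-V_{t+1}^\theta(y)[r].$$ Moreover $\mathcal P_t^*(x,a,\theta)$ is a polytope: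 it is the set of second marginals of the optimal face (set of optimal solutions) of the linear program, over $\gamma\in\mathbb R_{\ge0}^{\mathcal X\times\mathcal X}$, $$\min_{\gamma\ge0}\ \sum_{x',y\in\mathcal X}\gamma(x',y)H_\theta(y)\quad\text{s.t.}\quad\sum_{y\in\mathcal X}\gamma(x',y)=\mathbb P_t^0(x,a,\{x'\})\ \ \forall x'\in\mathcal X,\quad\sum_{x',y\in\mathcal X}\gamma(x',y)\,c(x',y)\le\varepsilon^q.$$
   Context: $\mathcal X\subset\mathbb R^d$, $A\subset\mathbb R^m$ are nonempty finite sets, $T\ge1$ an integer, $\mathcal T=\{0,\dots,T-1\}$, $\bar{\mathcal T}=\{0,\dots,T\}$, $q\ge1$ an integer, $c(x',y)=\|x'-y\|^q$ (Euclidean norm), $W_q$ the $q$-Wasserstein distance on $\mathcal P(\mathcal X)$ for the Euclidean metric. Rewards $f:\mathcal T\times\mathcal X\times A\times\mathcal X\to\mathbb R$, $g:\mathcal X\to\mathbb R$. $\mathbb P_t^0(x,a,\cdot)\in\mathcal P(\mathcal X)$ are nominal transition laws and $\mathbb B_t(x,a)=\{\mathbb P\in\mathcal P(\mathcal X):W_q(\mathbb P,\mathbb P_t^0(x,a,\cdot))\le\varepsilon\}$. Policies: $\Theta\subset\mathbb R^{d_\theta}$ compact; for $\theta\in\Theta$, $\pi_t^\theta(x,\cdot)$ is a probability mass function on $A$ (density with respect to counting measure). The policy class is regular if, for each $t\in\mathcal T$, $(\theta,x)\mapsto\pi_t^\theta(x,\cdot)$ is (weakly) continuous, $\theta\mapsto\sum_a\varphi(a)\pi_t^\theta(x,a)$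 is $C^1$ on $\Theta$ with derivative continuous in $(\theta,x)$ for every $\varphi:A\to\mathbb R$, and the score $\nabla_\theta\log\pi_t^\theta(x,a)$ exists and is bounded uniformly in $(\theta,t,x,a)$. Robust value functions: $V_t^\theta(x)$ is the infimum of $\mathbb E\big[\sum_{l=t}^{T-1}f(l,X_l,a_l,X_{l+1})+g(X_T)\big]$ over the laws of processes started at $X_t=x$ with $a_l\sim\pi_l^\theta(X_l,\cdot)$ and $X_{l+1}\sim\mathbb P_l(X_l,a_l,\cdot)$, where the kernels satisfy $\mathbb P_l(x',a',\cdot)\in\mathbb B_l(x',a')$ for all $(x',a')$. Equivalently $V_T^\theta=g$, $V_t^\theta(x)=\sum_a\pi_t^\theta(x,a)G_t^\theta(x,a)$ with the robust state-action value $G_t^\theta(x,a)=\min_{\mathbb P\in\mathbb B_t(x,a)}\sum_y\mathbb P(\{y\})(f(t,x,a,y)+V_{t+1}^\theta(y))$ (which, by Wasserstein duality, equals $\sup_{\lambda\ge0}\{\sum_{x'}\mathbb P_t^0(x,a,\{x'\})\min_y[f(t,x,a,y)+V_{t+1}^\theta(y)+\lambda c(x',y)]-\varepsilon^q\lambda\}$). Directional derivatives: $D_\theta^+\phi(\theta)[r]=\lim_{h\downarrow0}(\phi(\theta+hr)-\phi(\theta))/h$, $D_\theta^-\phi(\theta)[r]=\lim_{h\uparrow0}(\phi(\theta+hr)-\phi(\theta))/h$. The second marginal of $\gamma$ is $y\mapsto\sum_{x'}\gamma(x',y)$. *)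

theory Defs
  imports "HOL-Probability.Probability" "HOL-Library.Function_Algebras"
begin

(* Pointwise scalar multiplication, so that the library's convex hull and polytope
   apply to sets of mass functions. *)
instantiation "fun" :: (type, real_vector) real_vector
begin

definition scaleR_fun :: "real \<Rightarrow> ('a \<Rightarrow> 'b) \<Rightarrow> 'a \<Rightarrow> 'b"
  where "scaleR_fun c F = (\<lambda>i. c *\<^sub>R F i)"

instance
  by standard (simp_all add: scaleR_fun_def fun_eq_iff scaleR_add_right scaleR_add_left)

end

definition couplings :: "'s pmf \<Rightarrow> 's pmf \<Rightarrow> ('s \<times> 's) pmf set"
  where "couplings \<mu> \<nu> = {\<gamma>. map_pmf fst \<gamma> = \<mu> \<and> map_pmf snd \<gamma> = \<nu>}"

definition cost :: "nat \<Rightarrow> 's::real_normed_vector \<Rightarrow> 's \<Rightarrow> real"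
  where "cost q x' y = norm (x' - y) ^ q"

(* Meaningful only when the costs are integrable, e.g. for laws of finite support. *)
definition wasserstein :: "nat \<Rightarrow> 's::real_normed_vector pmf \<Rightarrow> 's pmf \<Rightarrow> real"
  where "wasserstein q \<mu> \<nu> =
    root q (INF \<gamma>\<in>couplings \<mu> \<nu>. measure_pmf.expectation \<gamma> (\<lambda>(x', y). cost q x' y))"

definition wasserstein_ball ::
    "nat \<Rightarrow> real \<Rightarrow> 's::real_normed_vector set \<Rightarrow> 's pmf \<Rightarrow> 's pmf set"
  where "wasserstein_ball q \<epsilon> X \<mu> = {P. set_pmf P \<subseteq> X \<and> wasserstein q P \<mu> \<le> \<epsilon>}"

(* Joint law of the state and action sequences after n steps, started in x at time t.
   Coordinates that are not yet reached, and those before t, hold dummy values. *)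
primrec path_law ::
    "(nat \<Rightarrow> 's \<Rightarrow> 'a pmf) \<Rightarrow> (nat \<Rightarrow> 's \<Rightarrow> 'a \<Rightarrow> 's pmf) \<Rightarrow> nat \<Rightarrow> 's \<Rightarrow> nat
      \<Rightarrow> ((nat \<Rightarrow> 's) \<times> (nat \<Rightarrow> 'a)) pmf"
  where
    "path_law p \<kappa> t x 0 = return_pmf (\<lambda>_. x, \<lambda>_. undefined)"
  | "path_law p \<kappa> t x (Suc n) =
      bind_pmf (path_law p \<kappa> t x n) (\<lambda>(S, \<alpha>).
        bind_pmf (p (t + n) (S (t + n))) (\<lambda>b.
          map_pmf (\<lambda>y. (S(Suc (t + n) := y), \<alpha>(t + n := b))) (\<kappa> (t + n) (S (t + n)) b)))"

definition expected_reward ::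
    "nat \<Rightarrow> (nat \<Rightarrow> 's \<Rightarrow> 'a \<Rightarrow> 's \<Rightarrow> real) \<Rightarrow> ('s \<Rightarrow> real) \<Rightarrow> (nat \<Rightarrow> 's \<Rightarrow> 'a pmf)
      \<Rightarrow> (nat \<Rightarrow> 's \<Rightarrow> 'a \<Rightarrow> 's pmf) \<Rightarrow> nat \<Rightarrow> 's \<Rightarrow> real"
  where "expected_reward T f g p \<kappa> t x =
    measure_pmf.expectation (path_law p \<kappa> t x (T - t))
      (\<lambda>(S, \<alpha>). (\<Sum>l=t..<T. f l (S l) (\<alpha> l) (S (Suc l))) + g (S T))"

definition ambiguity_kernels ::
    "nat \<Rightarrow> real \<Rightarrow> 's::real_normed_vector set \<Rightarrow> 'a set \<Rightarrow> nat
      \<Rightarrow> (nat \<Rightarrow> 's \<Rightarrow> 'a \<Rightarrow> 's pmf) \<Rightarrow> (nat \<Rightarrow> 's \<Rightarrow> 'a \<Rightarrow> 's pmf) set"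
  where "ambiguity_kernels q \<epsilon> X A T P0 =
    {\<kappa>. \<forall>l<T. \<forall>x\<in>X. \<forall>a\<in>A. \<kappa> l x a \<in> wasserstein_ball q \<epsilon> X (P0 l x a)}"

definition robust_value ::
    "nat \<Rightarrow> real \<Rightarrow> 's::real_normed_vector set \<Rightarrow> 'a set \<Rightarrow> nat
      \<Rightarrow> (nat \<Rightarrow> 's \<Rightarrow> 'a \<Rightarrow> 's \<Rightarrow> real) \<Rightarrow> ('s \<Rightarrow> real) \<Rightarrow> (nat \<Rightarrow> 's \<Rightarrow> 'a \<Rightarrow> 's pmf)
      \<Rightarrow> (nat \<Rightarrow> 's \<Rightarrow> 'a pmf) \<Rightarrow> nat \<Rightarrow> 's \<Rightarrow> real"
  where "robust_value q \<epsilon> X A T f g P0 p t x =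
    (INF \<kappa>\<in>ambiguity_kernels q \<epsilon> X A T P0. expected_reward T f g p \<kappa> t x)"

(* The infimum is a minimum whenever worst_case_laws below is nonempty for this H,
   which the theorem asserts through its minimum over that set. *)
definition robust_action_value ::
    "nat \<Rightarrow> real \<Rightarrow> 's::real_normed_vector set \<Rightarrow> 'a set \<Rightarrow> nat
      \<Rightarrow> (nat \<Rightarrow> 's \<Rightarrow> 'a \<Rightarrow> 's \<Rightarrow> real) \<Rightarrow> ('s \<Rightarrow> real) \<Rightarrow> (nat \<Rightarrow> 's \<Rightarrow> 'a \<Rightarrow> 's pmf)
      \<Rightarrow> (nat \<Rightarrow> 's \<Rightarrow> 'a pmf) \<Rightarrow> nat \<Rightarrow> 's \<Rightarrow> 'a \<Rightarrow> real"
  where "robust_action_value q \<epsilon> X A T f g P0 p t x a =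
    (INF P\<in>wasserstein_ball q \<epsilon> X (P0 t x a).
      \<Sum>y\<in>X. pmf P y * (f t x a y + robust_value q \<epsilon> X A T f g P0 p (Suc t) y))"

definition worst_case_laws ::
    "nat \<Rightarrow> real \<Rightarrow> 's::real_normed_vector set \<Rightarrow> 's pmf \<Rightarrow> ('s \<Rightarrow> real) \<Rightarrow> 's pmf set"
  where "worst_case_laws q \<epsilon> X \<mu> H =
    {P. is_arg_min (\<lambda>P. \<Sum>y\<in>X. pmf P y * H y) (\<lambda>P. P \<in> wasserstein_ball q \<epsilon> X \<mu>) P}"

(* Matrices indexed by X and X are encoded as functions vanishing off X and X. *)
definition transport_feasible ::
    "nat \<Rightarrow> real \<Rightarrow> 's::real_normed_vector set \<Rightarrow> 's pmf \<Rightarrow> ('s \<Rightarrow> 's \<Rightarrow> real) set"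
  where "transport_feasible q \<epsilon> X \<mu> =
    {\<gamma>. (\<forall>x' y. x' \<notin> X \<or> y \<notin> X \<longrightarrow> \<gamma> x' y = 0) \<and>
        (\<forall>x'\<in>X. \<forall>y\<in>X. 0 \<le> \<gamma> x' y) \<and>
        (\<forall>x'\<in>X. (\<Sum>y\<in>X. \<gamma> x' y) = pmf \<mu> x') \<and>
        (\<Sum>x'\<in>X. \<Sum>y\<in>X. \<gamma> x' y * cost q x' y) \<le> \<epsilon> ^ q}"

definition transport_optimal ::
    "nat \<Rightarrow> real \<Rightarrow> 's::real_normed_vector set \<Rightarrow> 's pmf \<Rightarrow> ('s \<Rightarrow> real) \<Rightarrow> ('s \<Rightarrow> 's \<Rightarrow> real) set"
  where "transport_optimal q \<epsilon> X \<mu> H =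
    {\<gamma>. is_arg_min (\<lambda>\<gamma>. \<Sum>x'\<in>X. \<Sum>y\<in>X. \<gamma> x' y * H y)
          (\<lambda>\<gamma>. \<gamma> \<in> transport_feasible q \<epsilon> X \<mu>) \<gamma>}"

definition second_marginal :: "'s set \<Rightarrow> ('s \<Rightarrow> 's \<Rightarrow> real) \<Rightarrow> 's \<Rightarrow> real"
  where "second_marginal X \<gamma> = (\<lambda>y. \<Sum>x'\<in>X. \<gamma> x' y)"

(* Derivatives on the parameter set are taken within it, so the hypothesis also makes
   sense at boundary points; at interior points this is the usual derivative.
   Since ln 0 = 0 here, existence of the score has to include positivity explicitly.
   On the finite set A every function is a bounded continuous test function. *)
definition regular_policy_class ::
    "'p::euclidean_space set \<Rightarrow> nat \<Rightarrow> 's::topological_space set \<Rightarrow> 'a set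
      \<Rightarrow> ('p \<Rightarrow> nat \<Rightarrow> 's \<Rightarrow> 'a pmf) \<Rightarrow> bool"
  where "regular_policy_class \<Theta> T X A \<pi> \<longleftrightarrow>
    (\<forall>t<T. \<forall>\<phi>::'a \<Rightarrow> real.
      continuous_on (\<Theta> \<times> X) (\<lambda>(\<theta>, x). \<Sum>a\<in>A. \<phi> a * pmf (\<pi> \<theta> t x) a)) \<and>
    (\<forall>t<T. \<forall>\<phi>::'a \<Rightarrow> real. \<exists>D :: 'p \<Rightarrow> 's \<Rightarrow> 'p.
      (\<forall>\<theta>\<in>\<Theta>. \<forall>x\<in>X. ((\<lambda>\<eta>. \<Sum>a\<in>A. \<phi> a * pmf (\<pi> \<eta> t x) a)
          has_derivative (\<lambda>h. h \<bullet> D \<theta> x)) (at \<theta> within \<Theta>)) \<and>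
      continuous_on (\<Theta> \<times> X) (\<lambda>(\<theta>, x). D \<theta> x)) \<and>
    (\<exists>(s :: 'p \<Rightarrow> nat \<Rightarrow> 's \<Rightarrow> 'a \<Rightarrow> 'p) C. \<forall>\<theta>\<in>\<Theta>. \<forall>t<T. \<forall>x\<in>X. \<forall>a\<in>A.
      0 < pmf (\<pi> \<theta> t x) a \<and>
      ((\<lambda>\<eta>. ln (pmf (\<pi> \<eta> t x) a))
          has_derivative (\<lambda>h. h \<bullet> s \<theta> t x a)) (at \<theta> within \<Theta>) \<and>
      norm (s \<theta> t x a) \<le> C)"

definition gradient :: "('p::real_inner \<Rightarrow> real) \<Rightarrow> 'p \<Rightarrow> 'p"
  where "gradient F \<theta> = (THE D. GDERIV F \<theta> :> D)"

definition diff_quotient :: "('p::real_vector \<Rightarrow> real) \<Rightarrow> 'p \<Rightarrow> 'p \<Rightarrow> real \<Rightarrow> real"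
  where "diff_quotient F \<theta> r h = (F (\<theta> + h *\<^sub>R r) - F \<theta>) / h"

definition dir_deriv_right_exists :: "('p::real_vector \<Rightarrow> real) \<Rightarrow> 'p \<Rightarrow> 'p \<Rightarrow> bool"
  where "dir_deriv_right_exists F \<theta> r \<longleftrightarrow> (\<exists>d. (diff_quotient F \<theta> r \<longlongrightarrow> d) (at_right 0))"

definition dir_deriv_left_exists :: "('p::real_vector \<Rightarrow> real) \<Rightarrow> 'p \<Rightarrow> 'p \<Rightarrow> bool"
  where "dir_deriv_left_exists F \<theta> r \<longleftrightarrow> (\<exists>d. (diff_quotient F \<theta> r \<longlongrightarrow> d) (at_left 0))"

definition dir_deriv_right :: "('p::real_vector \<Rightarrow> real) \<Rightarrow> 'p \<Rightarrow> 'p \<Rightarrow> real"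
  where "dir_deriv_right F \<theta> r = Lim (at_right 0) (diff_quotient F \<theta> r)"

definition dir_deriv_left :: "('p::real_vector \<Rightarrow> real) \<Rightarrow> 'p \<Rightarrow> 'p \<Rightarrow> real"
  where "dir_deriv_left F \<theta> r = Lim (at_left 0) (diff_quotient F \<theta> r)"

definition is_minimum_of :: "'b::order \<Rightarrow> 'b set \<Rightarrow> bool"
  where "is_minimum_of m S \<longleftrightarrow> m \<in> S \<and> (\<forall>s\<in>S. m \<le> s)"

definition is_maximum_of :: "'b::order \<Rightarrow> 'b set \<Rightarrow> bool"
  where "is_maximum_of m S \<longleftrightarrow> m \<in> S \<and> (\<forall>s\<in>S. s \<le> m)"

end

theory Submission
  imports Defs
begin

text \<open>Transport plans and couplings with prescribed marginals form sets cut out by finitely many affine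
  inequalities on which no direction is unbounded, hence polytopes. Optimal plans therefore exist, and
  the mass functions in a Wasserstein ball are exactly the second marginals of the feasible plans, the
  hull of finitely many laws independent of the objective. So the robust action value is the minimum of
  finitely many functions that are linear in the next value function, and the right derivative of such
  a minimum is the minimum of the right derivatives over the active members. The Bellman equation and
  the product rule carry this backwards in time. Left derivatives are negated right derivatives in the
  direction \<open>-r\<close>, which turns minima into maxima.\<close>

section \<open>Polytopes from affine inequalities\<close>

text \<open>Mass functions and plans are functions on a whole type, \<open>real ^ 'd\<close> in the
  theorem, so they do not live in a Euclidean space where compactness would give minimizers and
  extreme points. Counting active constraints replaces compactness: finiteness of the vertex set and
  attainment of linear minima become purely algebraic.

  In the calculus the obstacle is that \<open>V\<close> may have kinks in the parameter, because the
  worst-case law can switch. Differentiability is therefore lost along the recursion; what survives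
  is a one-sided derivative along a fixed ray, which is stable under finite sums, products and
  finite minima. The set of worst-case laws also moves with the parameter, but the finite list of
  candidates does not, since the ball depends only on the nominal law; so no continuity of
  minimizers is required. The list contains only some of the optimal laws. The others are covered by
  comparison: the objective of a fixed optimal law touches the robust value at the base parameter
  and never falls below it.\<close>

text \<open>Ratio test: move from \<open>x\<close> along \<open>d\<close> until some decreasing
  constraint first becomes tight. Constraints tight at \<open>x\<close> are constant along
  \<open>d\<close> and stay tight, while the one that stops the motion is new, so the inclusion is
  strict.\<close>

lemma halfline_exit:
  fixes x d :: "'v::real_vector" and l :: "'i \<Rightarrow> 'v \<Rightarrow> real"
  assumes I: "finite I" and lin: "\<And>i. i \<in> I \<Longrightarrow> linear (l i)"
    and x: "\<And>i. i \<in> I \<Longrightarrow> b i \<le> l i x"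
    and active: "\<And>i. i \<in> I \<Longrightarrow> l i x = b i \<Longrightarrow> l i d = 0"
    and exit: "\<exists>i\<in>I. l i d < 0"
  obtains t where "0 < t" "\<And>i. i \<in> I \<Longrightarrow> b i \<le> l i (x + t *\<^sub>R d)"
    "{i \<in> I. l i x = b i} \<subset> {i \<in> I. l i (x + t *\<^sub>R d) = b i}"
proof -
  define N where "N = {i \<in> I. l i d < 0}"
  define \<tau> where "\<tau> i = (l i x - b i) / (- l i d)" for i
  have N: "finite N" "N \<noteq> {}" using I exit by (auto simp: N_def)
  define t where "t = Min (\<tau> ` N)"
  have "t \<in> \<tau> ` N" unfolding t_def using N by (intro Min_in) auto
  then obtain k where k: "k \<in> N" "t = \<tau> k" by blast
  have l: "l i (x + t *\<^sub>R d) = l i x + t * l i d" if "i \<in> I" for i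
    using lin[OF that] by (simp add: linear_add linear_scale)
  have \<tau>pos: "0 < \<tau> i" if "i \<in> N" for i
  proof -
    have "b i \<noteq> l i x" using that active[of i] by (auto simp: N_def)
    then have "b i < l i x" using that x[of i] by (auto simp: N_def)
    then show ?thesis using that by (auto simp: N_def \<tau>_def intro!: divide_pos_neg)
  qed
  have tpos: "0 < t" using k \<tau>pos by simp
  have tle: "t \<le> \<tau> i" if "i \<in> N" for i using that N by (simp add: t_def)
  have ge: "b i \<le> l i (x + t *\<^sub>R d)" if "i \<in> I" for i
  proof (cases "i \<in> N")
    case True
    then have neg: "0 < - l i d" by (simp add: N_def)
    have "t * (- l i d) \<le> \<tau> i * (- l i d)" using tle[OF True] neg by (intro mult_right_mono) auto
    also have "\<dots> = l i x - b i" using neg by (simp add: \<tau>_def)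
    finally show ?thesis using l[OF that] by simp
  next
    case False
    then have "0 \<le> t * l i d" using that tpos by (simp add: N_def)
    then show ?thesis using l[OF that] x[OF that] by simp
  qed
  have kact: "l k (x + t *\<^sub>R d) = b k" "k \<in> I" "l k x \<noteq> b k"
    using k l[of k] active[of k] by (auto simp: N_def \<tau>_def)
  have "{i \<in> I. l i x = b i} \<subset> {i \<in> I. l i (x + t *\<^sub>R d) = b i}"
    using kact l active by (intro psubsetI) auto
  with tpos ge that show ?thesis by blast
qed

text \<open>The vertices are the points determined by their set of active constraints. Any other point
  lies strictly between two points of the set with more active constraints.\<close>

lemma polytope_affine_inequalities:
  fixes A S :: "'v::real_vector set" and l :: "'i \<Rightarrow> 'v \<Rightarrow> real"
  assumes I: "finite I" and lin: "\<And>i. i \<in> I \<Longrightarrow> linear (l i)" and A: "affine A"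
    and S: "S = {x \<in> A. \<forall>i\<in>I. b i \<le> l i x}"
    and sep: "\<And>u v. u \<in> S \<Longrightarrow> v \<in> S \<Longrightarrow> u \<noteq> v \<Longrightarrow> \<exists>i\<in>I. l i u < l i v"
  shows "polytope S"
proof -
  define act where "act x = {i \<in> I. l i x = b i}" for x
  define E where "E = {x \<in> S. \<forall>y\<in>S. act x \<subseteq> act y \<longrightarrow> y = x}"
  have finact: "finite (act x)" for x using I by (simp add: act_def)
  \<comment> \<open>Two members of \<open>E\<close> with the same active set are equal by
    maximality, so there are at most as many vertices as subsets of \<open>I\<close>.\<close>
  have "inj_on act E" by (rule inj_onI) (auto simp: E_def)
  moreover have "act ` E \<subseteq> Pow I" by (auto simp: act_def)
  ultimately have "finite E" using I by (meson finite_Pow_iff finite_subset inj_on_finite)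
  have conv: "convex S"
  proof -
    have "convex {x. b i \<le> l i x}" if "i \<in> I" for i
      using convex_linear_vimage[OF lin[OF that] convex_real_interval(1)[of "b i"]]
      by (simp add: vimage_def)
    moreover have "S = A \<inter> (\<Inter>i\<in>I. {x. b i \<le> l i x})" by (auto simp: S)
    ultimately show ?thesis using affine_imp_convex[OF A] by (auto intro!: convex_Int convex_INT)
  qed
  have "x \<in> convex hull E" if "x \<in> S" for x
    using that
  proof (induction "card I - card (act x)" arbitrary: x rule: less_induct)
    case less
    show ?case
    proof (cases "x \<in> E")
      case True
      then show ?thesis by (simp add: hull_inc)
    next
      case False
      then obtain y where y: "y \<in> S" "act x \<subseteq> act y" "y \<noteq> x" using less.prems by (auto simp: E_def)
      have dir: "l i (y - x) = l i y - l i x" "l i (x - y) = l i x - l i y" if "i \<in> I" for i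
        using lin[OF that] by (simp_all add: linear_diff)
      \<comment> \<open>Constraints active at \<open>x\<close> are active at \<open>y\<close> too,
        hence constant on the line through both points.\<close>
      have act0: "l i (y - x) = 0" "l i (x - y) = 0" if "i \<in> I" "l i x = b i" for i
        using y(2) that dir by (auto simp: act_def)
      have line: "x + t *\<^sub>R (y - x) \<in> A" for t
      proof -
        have "(1 - t) *\<^sub>R x + t *\<^sub>R y \<in> A" using A y less.prems by (auto simp: S intro!: mem_affine)
        then show ?thesis by (simp add: algebra_simps)
      qed
      have line': "x + t *\<^sub>R (x - y) \<in> A" for t
        using line[of "- t"] by (simp add: algebra_simps)
      have bx: "b i \<le> l i x" if "i \<in> I" for i using that less.prems by (simp add: S)
      \<comment> \<open>Using \<open>sep\<close> in both orders makes the line leave the set at both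
        ends, and each exit point has strictly more active constraints than
        \<open>x\<close>.\<close>
      obtain i where "i \<in> I" "l i y < l i x" using sep[OF y(1) less.prems y(3)] by blast
      then have "\<exists>i\<in>I. l i (y - x) < 0" using dir by (intro bexI[of _ i]) auto
      then obtain t where t: "0 < t" "\<And>i. i \<in> I \<Longrightarrow> b i \<le> l i (x + t *\<^sub>R (y - x))"
        "act x \<subset> act (x + t *\<^sub>R (y - x))"
        using halfline_exit[where I = I and l = l and b = b and x = x and d = "y - x", OF I lin bx act0(1)]
        unfolding act_def by blast
      obtain j where "j \<in> I" "l j x < l j y" using sep[OF less.prems y(1) y(3)[symmetric]] by blast
      then have "\<exists>i\<in>I. l i (x - y) < 0" using dir by (intro bexI[of _ j]) auto
      then obtain s where s: "0 < s" "\<And>i. i \<in> I \<Longrightarrow> b i \<le> l i (x + s *\<^sub>R (x - y))"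
        "act x \<subset> act (x + s *\<^sub>R (x - y))"
        using halfline_exit[where I = I and l = l and b = b and x = x and d = "x - y", OF I lin bx act0(2)]
        unfolding act_def by blast
      have hull: "z \<in> convex hull E" if "z \<in> S" "act x \<subset> act z" for z
      proof (rule less.hyps[OF _ that(1)])
        have "card (act x) < card (act z)" using that finact by (intro psubset_card_mono)
        moreover have "card (act z) \<le> card I" using I by (auto simp: act_def intro!: card_mono)
        ultimately show "card I - card (act z) < card I - card (act x)" by linarith
      qed
      have z: "x + t *\<^sub>R (y - x) \<in> convex hull E" "x + s *\<^sub>R (x - y) \<in> convex hull E"
        using t s line line' by (auto intro!: hull simp: S)
      \<comment> \<open>With these weights the displacements \<open>t\<close> along
        \<open>y - x\<close> and \<open>s\<close> along \<open>x - y\<close> cancel, so the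
        combination is \<open>x\<close>.\<close>
      have one: "s / (t + s) + t / (t + s) = 1"
        using t(1) s(1) by (simp add: add_divide_distrib[symmetric] add.commute)
      have "(s / (t + s)) *\<^sub>R (x + t *\<^sub>R (y - x)) + (t / (t + s)) *\<^sub>R (x + s *\<^sub>R (x - y)) \<in> convex hull E"
        using z t(1) s(1) one by (intro convexD convex_convex_hull) auto
      also have "(s / (t + s)) *\<^sub>R (x + t *\<^sub>R (y - x)) + (t / (t + s)) *\<^sub>R (x + s *\<^sub>R (x - y))
          = (s / (t + s) + t / (t + s)) *\<^sub>R x"
        by (simp add: algebra_simps)
      finally show ?thesis using one by simp
    qed
  qed
  moreover have "convex hull E \<subseteq> S" using conv by (intro hull_minimal) (auto simp: E_def)
  ultimately have "S = convex hull E" by blast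
  with \<open>finite E\<close> show ?thesis by (auto simp: polytope_def)
qed

text \<open>Otherwise the generators lie in the open half-space where \<open>L\<close> exceeds
  \<open>L x\<close>; it is convex, so it would contain the hull and \<open>x\<close>
  itself.\<close>

lemma convex_hull_linear_lower:
  fixes L :: "'v::real_vector \<Rightarrow> real"
  assumes "linear L" "x \<in> convex hull W"
  shows "\<exists>w\<in>W. L w \<le> L x"
proof (rule ccontr)
  assume "\<not> ?thesis"
  then have "W \<subseteq> L -` {L x<..}" by auto
  moreover have "convex (L -` {L x<..})" using assms(1) by (intro convex_linear_vimage) auto
  ultimately have "convex hull W \<subseteq> L -` {L x<..}" by (rule hull_minimal)
  with assms(2) show False by auto
qed

text \<open>A generator with the least value among the finitely many generators is a minimizer on
  the whole hull, so attainment involves no topology.\<close>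

lemma polytope_linear_minimum:
  fixes L :: "'v::real_vector \<Rightarrow> real"
  assumes "polytope S" "S \<noteq> {}" "linear L"
  obtains x where "x \<in> S" "\<And>y. y \<in> S \<Longrightarrow> L x \<le> L y"
proof -
  obtain W where W: "finite W" "S = convex hull W" using assms by (auto simp: polytope_def)
  then have "W \<noteq> {}" using assms by auto
  define w where "w = arg_min_on L W"
  have w: "w \<in> W" "\<And>v. v \<in> W \<Longrightarrow> L w \<le> L v"
    using W \<open>W \<noteq> {}\<close> arg_min_if_finite(1)[of W L] arg_min_least[of W _ L] by (auto simp: w_def)
  show ?thesis
  proof (rule that[of w])
    show "w \<in> S" using w W by (auto intro: hull_inc)
    show "L w \<le> L y" if "y \<in> S" for y
      using convex_hull_linear_lower[OF assms(3), of y W] that W w(2) by (fastforce intro: order_trans)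
  qed
qed

lemma linear_sum_fun:
  "linear (\<lambda>F::'i \<Rightarrow> real. \<Sum>i\<in>I. F i * H i)"
  by (rule linearI) (simp_all add: scaleR_fun_def algebra_simps sum.distrib sum_distrib_left)

lemma ex_pmf_of_weights:
  fixes F :: "'i \<Rightarrow> real"
  assumes "finite Z" "\<And>z. z \<in> Z \<Longrightarrow> 0 \<le> F z" "\<And>z. z \<notin> Z \<Longrightarrow> F z = 0" "sum F Z = 1"
  shows "\<exists>P. pmf P = F \<and> set_pmf P \<subseteq> Z"
proof -
  have nn: "0 \<le> F z" for z using assms(2,3) by (cases "z \<in> Z") auto
  have "(\<integral>\<^sup>+ z. ennreal (F z) \<partial>count_space UNIV) = (\<Sum>z\<in>Z. ennreal (F z))"
    using assms by (intro nn_integral_count_space'[OF assms(1)]) auto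
  also have "\<dots> = ennreal (sum F Z)" using assms(2) by (simp add: sum_ennreal)
  finally have "pmf (embed_pmf F) z = F z" for z using nn assms(4) by (intro pmf_embed_pmf) auto
  then show ?thesis using assms(3) by (intro exI[of _ "embed_pmf F"]) (auto simp: set_pmf_eq)
qed

section \<open>Transport plans and Wasserstein balls\<close>

text \<open>Supplies the separation hypothesis of \<open>polytope_affine_inequalities\<close>:
  vectors with a common prescribed sum cannot differ in one direction only.\<close>

lemma sum_eq_obtain_less:
  fixes u v :: "'i \<Rightarrow> real"
  assumes "finite I" "sum u I = sum v I" "i \<in> I" "u i \<noteq> v i"
  shows "\<exists>j\<in>I. u j < v j"
proof (rule ccontr)
  assume "\<not> ?thesis"
  then have "\<forall>j\<in>I. v j \<le> u j" by (auto simp: not_less)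
  moreover from this assms have "v i < u i" by force
  ultimately have "sum v I < sum u I" using assms by (intro sum_strict_mono_ex1) auto
  then show False using assms by simp
qed

lemma linear_eval: "linear (\<lambda>F::'i \<Rightarrow> real. F i)"
  by (rule linearI) (simp_all add: scaleR_fun_def)

lemma affine_linear_level:
  fixes L :: "'v::real_vector \<Rightarrow> real"
  assumes "linear L"
  shows "affine {x. L x = c}"
  unfolding affine_def
proof clarsimp
  fix x y :: 'v and u v :: real
  assume "L y = L x" "u + v = 1" "c = L x"
  have "L (u *\<^sub>R x + v *\<^sub>R y) = (u + v) * L x"
    using \<open>L y = L x\<close> assms by (simp add: linear_add linear_scale algebra_simps)
  then show "L (u *\<^sub>R x + v *\<^sub>R y) = L x" using \<open>u + v = 1\<close> by simp
qed

section \<open>Couplings on a finite set as a polytope of mass functions\<close>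

lemma set_pmf_coupling:
  assumes "\<kappa> \<in> couplings P \<mu>" "set_pmf P \<subseteq> X" "set_pmf \<mu> \<subseteq> X"
  shows "set_pmf \<kappa> \<subseteq> X \<times> X"
  using assms by (force simp: couplings_def)

lemma pmf_map_fst_finite:
  assumes "finite X" "set_pmf \<kappa> \<subseteq> Y \<times> X"
  shows "pmf (map_pmf fst \<kappa>) y = (\<Sum>x\<in>X. pmf \<kappa> (y, x))"
proof -
  have "pmf (map_pmf fst \<kappa>) y = measure \<kappa> (fst -` {y} \<inter> set_pmf \<kappa>)"
    by (simp add: pmf_map measure_Int_set_pmf)
  also have "fst -` {y} \<inter> set_pmf \<kappa> = ({y} \<times> X) \<inter> set_pmf \<kappa>" using assms by auto
  also have "measure \<kappa> \<dots> = (\<Sum>z\<in>{y} \<times> X. pmf \<kappa> z)"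
    using assms by (simp add: measure_Int_set_pmf measure_measure_pmf_finite)
  also have "\<dots> = (\<Sum>x\<in>X. pmf \<kappa> (y, x))" by (simp add: sum.cartesian_product')
  finally show ?thesis .
qed

lemma pmf_map_snd_finite:
  assumes "finite Y" "set_pmf \<kappa> \<subseteq> Y \<times> X"
  shows "pmf (map_pmf snd \<kappa>) x = (\<Sum>y\<in>Y. pmf \<kappa> (y, x))"
proof -
  have "pmf (map_pmf snd \<kappa>) x = measure \<kappa> (snd -` {x} \<inter> set_pmf \<kappa>)"
    by (simp add: pmf_map measure_Int_set_pmf)
  also have "snd -` {x} \<inter> set_pmf \<kappa> = (Y \<times> {x}) \<inter> set_pmf \<kappa>" using assms by auto
  also have "measure \<kappa> \<dots> = (\<Sum>z\<in>Y \<times> {x}. pmf \<kappa> z)"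
    using assms by (simp add: measure_Int_set_pmf measure_measure_pmf_finite)
  also have "\<dots> = (\<Sum>y\<in>Y. pmf \<kappa> (y, x))" by (simp add: sum.cartesian_product')
  finally show ?thesis .
qed

text \<open>The type \<open>pmf\<close> carries no vector space structure, so convexity is handled
  on mass functions and this is the dictionary. Total mass one follows from the first marginal;
  outside \<open>X\<close> both marginals vanish because all supports lie in
  \<open>X\<close>.\<close>

lemma pmf_image_couplings:
  assumes "finite X" "set_pmf P \<subseteq> X" "set_pmf \<mu> \<subseteq> X"
  shows "pmf ` couplings P \<mu> =
    {F. (\<forall>z. z \<notin> X \<times> X \<longrightarrow> F z = 0) \<and> (\<forall>z\<in>X \<times> X. 0 \<le> F z) \<and>
        (\<forall>y\<in>X. (\<Sum>x\<in>X. F (y, x)) = pmf P y) \<and> (\<forall>x\<in>X. (\<Sum>y\<in>X. F (y, x)) = pmf \<mu> x)}"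
    (is "_ = ?R")
proof (intro equalityI subsetI)
  fix F assume "F \<in> pmf ` couplings P \<mu>"
  then obtain \<kappa> where \<kappa>: "F = pmf \<kappa>" "\<kappa> \<in> couplings P \<mu>" by blast
  have supp: "set_pmf \<kappa> \<subseteq> X \<times> X" using set_pmf_coupling[OF \<kappa>(2) assms(2,3)] .
  show "F \<in> ?R"
    using \<kappa> supp pmf_map_fst_finite[OF assms(1) supp] pmf_map_snd_finite[OF assms(1) supp]
    by (auto simp: couplings_def set_pmf_eq)
next
  fix F assume F: "F \<in> ?R"
  have "sum F (X \<times> X) = (\<Sum>y\<in>X. pmf P y)" using F by (simp add: sum.cartesian_product')
  also have "\<dots> = 1" using assms by (intro sum_pmf_eq_1) auto
  finally obtain \<kappa> where \<kappa>: "pmf \<kappa> = F" "set_pmf \<kappa> \<subseteq> X \<times> X"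
    using ex_pmf_of_weights[of "X \<times> X" F] F assms(1) by auto
  have "map_pmf fst \<kappa> = P"
  proof (rule pmf_eqI)
    fix y show "pmf (map_pmf fst \<kappa>) y = pmf P y"
      using F \<kappa> assms by (cases "y \<in> X") (auto simp: pmf_map_fst_finite[OF assms(1) \<kappa>(2)] set_pmf_eq)
  qed
  moreover have "map_pmf snd \<kappa> = \<mu>"
  proof (rule pmf_eqI)
    fix x show "pmf (map_pmf snd \<kappa>) x = pmf \<mu> x"
      using F \<kappa> assms by (cases "x \<in> X") (auto simp: pmf_map_snd_finite[OF assms(1) \<kappa>(2)] set_pmf_eq)
  qed
  ultimately show "F \<in> pmf ` couplings P \<mu>" using \<kappa> by (auto simp: couplings_def)
qed

lemma expectation_coupling:
  assumes "finite X" "set_pmf \<kappa> \<subseteq> X \<times> X"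
  shows "measure_pmf.expectation \<kappa> h = (\<Sum>z\<in>X \<times> X. pmf \<kappa> z * h z)"
  using assms by (subst integral_measure_pmf_real[of "X \<times> X"]) (auto simp: mult.commute)

text \<open>The marginal equations go into the affine set and leave only nonnegativity as
  inequalities. Two distinct couplings differ in some row, whose sum both share, so an entry of that
  row separates them.\<close>

lemma polytope_couplings:
  assumes "finite X" "set_pmf P \<subseteq> X" "set_pmf \<mu> \<subseteq> X"
  shows "polytope (pmf ` couplings P \<mu>)"
proof (rule polytope_affine_inequalities[where I = "X \<times> X" and l = "\<lambda>z F. F z" and b = "\<lambda>_. 0"
    and A = "{F. (\<forall>z. z \<notin> X \<times> X \<longrightarrow> F z = 0) \<and>
        (\<forall>y\<in>X. (\<Sum>x\<in>X. F (y, x)) = pmf P y) \<and> (\<forall>x\<in>X. (\<Sum>y\<in>X. F (y, x)) = pmf \<mu> x)}"])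
  show "affine {F. (\<forall>z. z \<notin> X \<times> X \<longrightarrow> F z = 0) \<and>
        (\<forall>y\<in>X. (\<Sum>x\<in>X. F (y, x)) = pmf P y) \<and> (\<forall>x\<in>X. (\<Sum>y\<in>X. F (y, x)) = pmf \<mu> x)}"
    unfolding affine_def
    by (auto simp: scaleR_fun_def sum.distrib sum_distrib_left[symmetric] distrib_right[symmetric])
  fix u v assume uv: "u \<in> pmf ` couplings P \<mu>" "v \<in> pmf ` couplings P \<mu>" "u \<noteq> v"
  then obtain y x where ne: "u (y, x) \<noteq> v (y, x)" by (auto simp: fun_eq_iff)
  have yx: "(y, x) \<in> X \<times> X"
  proof (rule ccontr)
    assume "(y, x) \<notin> X \<times> X"
    then have "u (y, x) = 0" "v (y, x) = 0"
      using uv(1,2) unfolding pmf_image_couplings[OF assms] by blast+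
    then show False using ne by simp
  qed
  have "(\<Sum>x\<in>X. u (y, x)) = (\<Sum>x\<in>X. v (y, x))"
    using uv yx unfolding pmf_image_couplings[OF assms] by auto
  then obtain j where "j \<in> X" "u (y, j) < v (y, j)"
    using sum_eq_obtain_less[of X "\<lambda>x. u (y, x)" "\<lambda>x. v (y, x)" x] yx ne assms(1) by auto
  then show "\<exists>z\<in>X \<times> X. u z < v z" using yx by (intro bexI[of _ "(y, j)"]) auto
qed (use assms in \<open>auto simp: pmf_image_couplings[OF assms] linear_eval\<close>)

text \<open>Makes the infimum in \<open>wasserstein\<close> a minimum, so that membership in a ball
  yields a coupling within the budget exactly and not only up to slack. The product law shows that
  couplings exist.\<close>

lemma optimal_coupling:
  fixes h :: "'s \<times> 's \<Rightarrow> real"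
  assumes "finite X" "set_pmf P \<subseteq> X" "set_pmf \<mu> \<subseteq> X"
  obtains \<kappa> where "\<kappa> \<in> couplings P \<mu>"
    "\<And>\<kappa>'. \<kappa>' \<in> couplings P \<mu> \<Longrightarrow> measure_pmf.expectation \<kappa> h \<le> measure_pmf.expectation \<kappa>' h"
proof -
  have "pair_pmf P \<mu> \<in> couplings P \<mu>" by (simp add: couplings_def map_fst_pair_pmf map_snd_pair_pmf)
  then have ne: "pmf ` couplings P \<mu> \<noteq> {}" by blast
  obtain F where F: "F \<in> pmf ` couplings P \<mu>"
    "\<And>F'. F' \<in> pmf ` couplings P \<mu> \<Longrightarrow> (\<Sum>z\<in>X \<times> X. F z * h z) \<le> (\<Sum>z\<in>X \<times> X. F' z * h z)"
    using polytope_linear_minimum[OF polytope_couplings[OF assms] ne linear_sum_fun] by blast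
  show ?thesis
    using F that by (auto simp: expectation_coupling[OF assms(1) set_pmf_coupling[OF _ assms(2,3)]])
qed

lemma wasserstein_le_iff:
  fixes X :: "'s::real_normed_vector set"
  assumes "finite X" "set_pmf P \<subseteq> X" "set_pmf \<mu> \<subseteq> X" "1 \<le> q" "0 \<le> \<epsilon>"
  shows "wasserstein q P \<mu> \<le> \<epsilon> \<longleftrightarrow>
    (\<exists>\<kappa>\<in>couplings P \<mu>. (\<Sum>x'\<in>X. \<Sum>y\<in>X. pmf \<kappa> (y, x') * cost q x' y) \<le> \<epsilon> ^ q)"
proof -
  define h :: "'s \<times> 's \<Rightarrow> real" where "h = (\<lambda>(x', y). cost q x' y)"
  let ?E = "\<lambda>\<kappa>. measure_pmf.expectation \<kappa> h"
  \<comment> \<open>A coupling has the perturbed law in its first coordinate, whereas a transport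
    plan has the nominal law first. Hence the transposed arguments, the exchanged sums and the
    symmetry of the cost.\<close>
  have E: "?E \<kappa> = (\<Sum>x'\<in>X. \<Sum>y\<in>X. pmf \<kappa> (y, x') * cost q x' y)" if "\<kappa> \<in> couplings P \<mu>" for \<kappa>
    unfolding expectation_coupling[OF assms(1) set_pmf_coupling[OF that assms(2,3)]]
      sum.cartesian_product'
    by (subst sum.swap) (simp add: h_def cost_def norm_minus_commute)
  obtain \<kappa>0 where \<kappa>0: "\<kappa>0 \<in> couplings P \<mu>" "\<And>\<kappa>. \<kappa> \<in> couplings P \<mu> \<Longrightarrow> ?E \<kappa>0 \<le> ?E \<kappa>"
    using optimal_coupling[OF assms(1-3)] by blast
  have "(INF \<kappa>\<in>couplings P \<mu>. ?E \<kappa>) = ?E \<kappa>0"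
    using \<kappa>0 by (intro cInf_eq_minimum) auto
  then have "wasserstein q P \<mu> = root q (?E \<kappa>0)" by (simp add: wasserstein_def h_def)
  then have "wasserstein q P \<mu> \<le> \<epsilon> \<longleftrightarrow> root q (?E \<kappa>0) \<le> root q (\<epsilon> ^ q)"
    using assms by (simp add: real_root_power_cancel)
  also have "\<dots> \<longleftrightarrow> ?E \<kappa>0 \<le> \<epsilon> ^ q" using assms by (intro real_root_le_iff) simp
  also have "\<dots> \<longleftrightarrow> (\<exists>\<kappa>\<in>couplings P \<mu>. ?E \<kappa> \<le> \<epsilon> ^ q)" using \<kappa>0 by (force intro: order_trans)
  finally show ?thesis using E by auto
qed

section \<open>Wasserstein balls and worst-case laws as projections of transport plans\<close>

lemma self_in_wasserstein_ball:
  assumes "finite X" "set_pmf \<mu> \<subseteq> X" "1 \<le> q" "0 \<le> \<epsilon>"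
  shows "\<mu> \<in> wasserstein_ball q \<epsilon> X \<mu>"
proof -
  have "map_pmf (\<lambda>x. (x, x)) \<mu> \<in> couplings \<mu> \<mu>" by (simp add: couplings_def pmf.map_comp o_def)
  \<comment> \<open>Off the diagonal the mass is zero; on it the cost is \<open>0 ^ q\<close>, which
    is zero because \<open>1 \<le> q\<close>.\<close>
  moreover have "pmf (map_pmf (\<lambda>x. (x, x)) \<mu>) (y, x') * cost q x' y = 0" for x' y
    using assms(3) by (cases "x' = y") (auto simp: cost_def pmf_eq_0_set_pmf)
  then have "(\<Sum>x'\<in>X. \<Sum>y\<in>X. pmf (map_pmf (\<lambda>x. (x, x)) \<mu>) (y, x') * cost q x' y) \<le> \<epsilon> ^ q"
    using assms(4) by (simp only: sum.neutral_const zero_le_power)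
  ultimately have "wasserstein q \<mu> \<mu> \<le> \<epsilon>"
    unfolding wasserstein_le_iff[OF assms(1,2,2,3,4)] by blast
  then show ?thesis using assms(2) by (simp add: wasserstein_ball_def)
qed

text \<open>A feasible plan is a transposed coupling whose perturbed marginal is left free. Summing
  out the nominal coordinate recovers that marginal, and the budget is the ball condition raised to
  the power \<open>q\<close>.\<close>

lemma pmf_image_wasserstein_ball:
  assumes "finite X" "set_pmf \<mu> \<subseteq> X" "1 \<le> q" "0 \<le> \<epsilon>"
  shows "pmf ` wasserstein_ball q \<epsilon> X \<mu> = second_marginal X ` transport_feasible q \<epsilon> X \<mu>"
proof (intro equalityI subsetI)
  fix F assume "F \<in> pmf ` wasserstein_ball q \<epsilon> X \<mu>"
  then obtain P where P: "F = pmf P" "set_pmf P \<subseteq> X" "wasserstein q P \<mu> \<le> \<epsilon>"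
    by (auto simp: wasserstein_ball_def)
  then obtain \<kappa> where \<kappa>: "\<kappa> \<in> couplings P \<mu>"
    "(\<Sum>x'\<in>X. \<Sum>y\<in>X. pmf \<kappa> (y, x') * cost q x' y) \<le> \<epsilon> ^ q"
    using wasserstein_le_iff[OF assms(1) P(2) assms(2-)] by blast
  have w: "pmf \<kappa> \<in> pmf ` couplings P \<mu>" using \<kappa> by simp
  have "(\<lambda>x' y. pmf \<kappa> (y, x')) \<in> transport_feasible q \<epsilon> X \<mu>"
    using w \<kappa>(2) unfolding pmf_image_couplings[OF assms(1) P(2) assms(2)]
    by (auto simp: transport_feasible_def)
  moreover have "F = second_marginal X (\<lambda>x' y. pmf \<kappa> (y, x'))"
  proof
    fix y show "F y = second_marginal X (\<lambda>x' y. pmf \<kappa> (y, x')) y"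
      using w P(1,2) unfolding pmf_image_couplings[OF assms(1) P(2) assms(2)]
      by (cases "y \<in> X") (auto simp: second_marginal_def set_pmf_eq)
  qed
  ultimately show "F \<in> second_marginal X ` transport_feasible q \<epsilon> X \<mu>" by blast
next
  fix F assume "F \<in> second_marginal X ` transport_feasible q \<epsilon> X \<mu>"
  then obtain \<gamma> where \<gamma>: "\<gamma> \<in> transport_feasible q \<epsilon> X \<mu>" and F: "F = second_marginal X \<gamma>" by blast
  have off: "\<gamma> x' y = 0" if "x' \<notin> X \<or> y \<notin> X" for x' y
    using \<gamma> that by (auto simp: transport_feasible_def)
  have nn: "0 \<le> \<gamma> x' y" for x' y
    using \<gamma> off by (cases "x' \<in> X \<and> y \<in> X") (auto simp: transport_feasible_def)
  have "sum F X = (\<Sum>x'\<in>X. \<Sum>y\<in>X. \<gamma> x' y)" unfolding F second_marginal_def by (rule sum.swap)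
  also have "\<dots> = (\<Sum>x'\<in>X. pmf \<mu> x')" using \<gamma> by (simp add: transport_feasible_def)
  also have "\<dots> = 1" using assms by (intro sum_pmf_eq_1) auto
  finally obtain P where P: "pmf P = F" "set_pmf P \<subseteq> X"
    using ex_pmf_of_weights[of X F] assms(1) nn off by (auto simp: F second_marginal_def sum_nonneg)
  have "(\<lambda>(y, x'). \<gamma> x' y) \<in> pmf ` couplings P \<mu>"
    unfolding pmf_image_couplings[OF assms(1) P(2) assms(2)]
    using \<gamma> nn off by (auto simp: P(1) F second_marginal_def transport_feasible_def)
  then obtain \<kappa> where \<kappa>: "\<kappa> \<in> couplings P \<mu>" "pmf \<kappa> = (\<lambda>(y, x'). \<gamma> x' y)" by fastforce
  have "(\<Sum>x'\<in>X. \<Sum>y\<in>X. pmf \<kappa> (y, x') * cost q x' y) \<le> \<epsilon> ^ q"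
    using \<gamma> by (simp add: \<kappa>(2) transport_feasible_def)
  then have "P \<in> wasserstein_ball q \<epsilon> X \<mu>"
    using \<kappa>(1) P(2) wasserstein_le_iff[OF assms(1) P(2) assms(2-)] by (auto simp: wasserstein_ball_def)
  then show "F \<in> pmf ` wasserstein_ball q \<epsilon> X \<mu>" using P(1) by blast
qed

lemma linear_second_marginal: "linear (second_marginal X)"
  by (rule linearI) (auto simp: second_marginal_def scaleR_fun_def fun_eq_iff sum.distrib sum_distrib_left)

lemma linear_double_sum:
  "linear (\<lambda>\<gamma>::'s \<Rightarrow> 's \<Rightarrow> real. \<Sum>x\<in>X. \<Sum>y\<in>X. \<gamma> x y * h x y)"
  by (rule linearI) (simp_all add: scaleR_fun_def algebra_simps sum.distrib sum_distrib_left)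

text \<open>The extra affine set lets one argument serve twice: \<open>UNIV\<close> gives the
  feasible set, a level set of the objective gives the optimal face.\<close>

lemma polytope_transport_feasible_Int:
  assumes "finite X" "affine B"
  shows "polytope (transport_feasible q \<epsilon> X \<mu> \<inter> B)"
proof -
  define A where "A = {\<gamma>. (\<forall>x' y. x' \<notin> X \<or> y \<notin> X \<longrightarrow> \<gamma> x' y = 0) \<and>
    (\<forall>x'\<in>X. (\<Sum>y\<in>X. \<gamma> x' y) = pmf \<mu> x')}"
  \<comment> \<open>Index \<open>None\<close> is the transport budget, with its sign reversed to fit
    \<open>b i \<le> l i \<gamma>\<close>; index \<open>Some (x', y)\<close> is nonnegativity of one
    entry.\<close>
  define l where "l i \<gamma> = (case i of None \<Rightarrow> \<Sum>x'\<in>X. \<Sum>y\<in>X. \<gamma> x' y * (- cost q x' y)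
    | Some (x', y) \<Rightarrow> \<gamma> x' y)" for i and \<gamma> :: "'a \<Rightarrow> 'a \<Rightarrow> real"
  define b where "b i = (case i of None \<Rightarrow> - (\<epsilon> ^ q) | Some _ \<Rightarrow> 0)" for i :: "('a \<times> 'a) option"
  define I where "I = insert None (Some ` (X \<times> X))"
  show ?thesis
  proof (rule polytope_affine_inequalities[where I = I and l = l and b = b and A = "A \<inter> B"])
    show "finite I" using assms by (simp add: I_def)
    show "linear (l i)" for i
      by (cases i; rule linearI)
        (auto simp: l_def scaleR_fun_def algebra_simps sum.distrib sum_distrib_left sum_subtractf sum_negf)
    have "affine A" unfolding A_def affine_def
      by (auto simp: scaleR_fun_def sum.distrib sum_distrib_left[symmetric] distrib_right[symmetric])
    then show "affine (A \<inter> B)" using assms by (intro affine_Int)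
    show S: "transport_feasible q \<epsilon> X \<mu> \<inter> B = {\<gamma> \<in> A \<inter> B. \<forall>i\<in>I. b i \<le> l i \<gamma>}"
      by (auto simp: transport_feasible_def A_def I_def l_def b_def sum_negf)
    fix u v assume uv: "u \<in> transport_feasible q \<epsilon> X \<mu> \<inter> B" "v \<in> transport_feasible q \<epsilon> X \<mu> \<inter> B" "u \<noteq> v"
    then obtain x y where xy: "u x y \<noteq> v x y" by (auto simp: fun_eq_iff)
    then have X: "x \<in> X" "y \<in> X" using uv by (fastforce simp: transport_feasible_def)+
    have "(\<Sum>y\<in>X. u x y) = (\<Sum>y\<in>X. v x y)" using uv X by (auto simp: transport_feasible_def)
    then obtain z where "z \<in> X" "u x z < v x z"
      using sum_eq_obtain_less[of X "u x" "v x" y] xy X assms(1) by auto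
    then show "\<exists>i\<in>I. l i u < l i v" using X
      by (intro bexI[of _ "Some (x, z)"]) (auto simp: I_def l_def)
  qed
qed

text \<open>The objective sees a plan only through its second marginal; this is why minimizing over
  plans and minimizing over laws select corresponding sets.\<close>

lemma transport_objective:
  "(\<Sum>x'\<in>X. \<Sum>y\<in>X. \<gamma> x' y * H y) = (\<Sum>y\<in>X. second_marginal X \<gamma> y * H y)"
  unfolding second_marginal_def sum_distrib_right by (rule sum.swap)

lemma pmf_image_worst_case_laws:
  assumes "finite X" "set_pmf \<mu> \<subseteq> X" "1 \<le> q" "0 \<le> \<epsilon>"
  shows "pmf ` worst_case_laws q \<epsilon> X \<mu> H = second_marginal X ` transport_optimal q \<epsilon> X \<mu> H"
proof -
  let ?obj = "\<lambda>F. \<Sum>y\<in>X. F y * H y"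
  have "pmf ` worst_case_laws q \<epsilon> X \<mu> H =
      {F \<in> pmf ` wasserstein_ball q \<epsilon> X \<mu>. \<forall>F'\<in>pmf ` wasserstein_ball q \<epsilon> X \<mu>. ?obj F \<le> ?obj F'}"
    by (auto simp: worst_case_laws_def is_arg_min_linorder)
  also have "\<dots> = second_marginal X ` transport_optimal q \<epsilon> X \<mu> H"
    unfolding pmf_image_wasserstein_ball[OF assms]
    by (auto simp: transport_optimal_def is_arg_min_linorder transport_objective)
  finally show ?thesis .
qed

text \<open>Optimal plans are the feasible plans on the level set of the minimal value, an affine
  cut of the polytope. The second marginal is linear, so it maps the hull of the generators to the
  hull of their images.\<close>

lemma polytope_worst_case_laws:
  assumes "finite X" "set_pmf \<mu> \<subseteq> X" "1 \<le> q" "0 \<le> \<epsilon>"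
  shows "polytope (pmf ` worst_case_laws q \<epsilon> X \<mu> H)"
proof -
  let ?obj = "\<lambda>\<gamma>. \<Sum>x'\<in>X. \<Sum>y\<in>X. \<gamma> x' y * H y"
  have feas: "polytope (transport_feasible q \<epsilon> X \<mu>)"
    using polytope_transport_feasible_Int[OF assms(1) affine_UNIV] by simp
  have "transport_feasible q \<epsilon> X \<mu> \<noteq> {}"
    using self_in_wasserstein_ball[OF assms] pmf_image_wasserstein_ball[OF assms] by auto
  then obtain \<gamma>0 where \<gamma>0: "\<gamma>0 \<in> transport_feasible q \<epsilon> X \<mu>"
    "\<And>\<gamma>. \<gamma> \<in> transport_feasible q \<epsilon> X \<mu> \<Longrightarrow> ?obj \<gamma>0 \<le> ?obj \<gamma>"
    using polytope_linear_minimum[OF feas _ linear_double_sum[where X = X and h = "\<lambda>_. H"]] by blast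
  have "transport_optimal q \<epsilon> X \<mu> H = transport_feasible q \<epsilon> X \<mu> \<inter> {\<gamma>. ?obj \<gamma> = ?obj \<gamma>0}"
    unfolding transport_optimal_def is_arg_min_linorder using \<gamma>0(1) by (auto intro!: antisym \<gamma>0(2))
  then have "polytope (transport_optimal q \<epsilon> X \<mu> H)"
    using polytope_transport_feasible_Int[OF assms(1) affine_linear_level[OF linear_double_sum[where X = X and h = "\<lambda>_. H"]]]
    by simp
  then obtain W where "finite W" "transport_optimal q \<epsilon> X \<mu> H = convex hull W"
    by (auto simp: polytope_def)
  then have "finite (second_marginal X ` W)"
    "second_marginal X ` transport_optimal q \<epsilon> X \<mu> H = convex hull (second_marginal X ` W)"
    by (auto simp: convex_hull_linear_image[OF linear_second_marginal])
  then show ?thesis unfolding pmf_image_worst_case_laws[OF assms] polytope_def by blast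
qed

text \<open>\<open>Q\<close> represents the projected generators of the plan polytope. It is fixed
  before \<open>H\<close>, so one list serves every parameter on a ray.\<close>

lemma finite_minimizing_laws:
  assumes "finite X" "set_pmf \<mu> \<subseteq> X" "1 \<le> q" "0 \<le> \<epsilon>"
  obtains Q where "finite Q" "Q \<noteq> {}" "Q \<subseteq> wasserstein_ball q \<epsilon> X \<mu>"
    "\<And>P H. P \<in> wasserstein_ball q \<epsilon> X \<mu> \<Longrightarrow>
      \<exists>P'\<in>Q. (\<Sum>y\<in>X. pmf P' y * H y) \<le> (\<Sum>y\<in>X. pmf P y * H y)"
proof -
  have "polytope (transport_feasible q \<epsilon> X \<mu>)"
    using polytope_transport_feasible_Int[OF assms(1) affine_UNIV] by simp
  then obtain W where W: "finite W" "transport_feasible q \<epsilon> X \<mu> = convex hull W"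
    by (auto simp: polytope_def)
  then have hull: "pmf ` wasserstein_ball q \<epsilon> X \<mu> = convex hull (second_marginal X ` W)"
    unfolding pmf_image_wasserstein_ball[OF assms]
    by (auto simp: convex_hull_linear_image[OF linear_second_marginal])
  then have "second_marginal X ` W \<subseteq> pmf ` wasserstein_ball q \<epsilon> X \<mu>" by (simp add: hull_subset)
  then obtain Q where Q: "finite Q" "Q \<subseteq> wasserstein_ball q \<epsilon> X \<mu>" "second_marginal X ` W = pmf ` Q"
    using W(1) finite_subset_image by (metis finite_imageI)
  have min: "\<exists>P'\<in>Q. (\<Sum>y\<in>X. pmf P' y * H y) \<le> (\<Sum>y\<in>X. pmf P y * H y)"
    if "P \<in> wasserstein_ball q \<epsilon> X \<mu>" for P H
    using convex_hull_linear_lower[OF linear_sum_fun[where I = X and H = H], of "pmf P" "pmf ` Q"] that hull Q(3) by auto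
  moreover have "Q \<noteq> {}" using min[OF self_in_wasserstein_ball[OF assms]] by auto
  ultimately show ?thesis using Q that by blast
qed

section \<open>Dynamic programming\<close>

text \<open>Backward induction for kernels chosen at each step from an arbitrary set of laws. With the sets
  \<open>{\<kappa> l x a}\<close> it evaluates the fixed kernels \<open>\<kappa>\<close>. The index \<open>n\<close> is the number of remaining steps.\<close>

primrec backward_value ::
    "'s set \<Rightarrow> 'a set \<Rightarrow> nat \<Rightarrow> (nat \<Rightarrow> 's \<Rightarrow> 'a \<Rightarrow> 's \<Rightarrow> real) \<Rightarrow> ('s \<Rightarrow> real)
      \<Rightarrow> (nat \<Rightarrow> 's \<Rightarrow> 'a pmf) \<Rightarrow> (nat \<Rightarrow> 's \<Rightarrow> 'a \<Rightarrow> 's pmf set) \<Rightarrow> nat \<Rightarrow> 's \<Rightarrow> real"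
  where
    "backward_value X A T f g p K 0 x = g x"
  | "backward_value X A T f g p K (Suc n) x =
      (\<Sum>a\<in>A. pmf (p (T - Suc n) x) a *
        (INF P\<in>K (T - Suc n) x a.
          \<Sum>y\<in>X. pmf P y * (f (T - Suc n) x a y + backward_value X A T f g p K n y)))"

lemma sum_pmf_affine:
  assumes "finite A" "set_pmf M \<subseteq> A"
  shows "(\<Sum>a\<in>A. pmf M a * (c + h a)) = c + (\<Sum>a\<in>A. pmf M a * h a)"
  using sum_pmf_eq_1[OF assms] by (simp add: algebra_simps sum.distrib sum_distrib_left[symmetric])

lemma expectation_finite_support:
  fixes h :: "'b \<Rightarrow> real"
  assumes "finite A" "set_pmf M \<subseteq> A"
  shows "measure_pmf.expectation M h = (\<Sum>a\<in>A. pmf M a * h a)"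
  using assms by (subst integral_measure_pmf_real[of A]) (auto simp: mult.commute)

lemma expectation_bind_finite:
  fixes h :: "'c \<Rightarrow> real"
  assumes "finite A" "set_pmf M \<subseteq> A" "\<And>a. a \<in> A \<Longrightarrow> finite (set_pmf (N a))"
  shows "measure_pmf.expectation (bind_pmf M N) h = (\<Sum>a\<in>A. pmf M a * measure_pmf.expectation (N a) h)"
  using assms by (subst pmf_expectation_bind[of A]) auto

section \<open>Evaluation of fixed kernels\<close>

context
  fixes X :: "'s set" and A :: "'a set" and T :: nat
    and p :: "nat \<Rightarrow> 's \<Rightarrow> 'a pmf" and \<kappa> :: "nat \<Rightarrow> 's \<Rightarrow> 'a \<Rightarrow> 's pmf"
  assumes finX: "finite X" and finA: "finite A"
    and p: "\<And>l x. l < T \<Longrightarrow> x \<in> X \<Longrightarrow> set_pmf (p l x) \<subseteq> A"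
    and \<kappa>: "\<And>l x a. l < T \<Longrightarrow> x \<in> X \<Longrightarrow> a \<in> A \<Longrightarrow> set_pmf (\<kappa> l x a) \<subseteq> X"
begin

text \<open>Finite support turns path expectations into finite sums; the current state staying in
  \<open>X\<close> is what lets the support assumptions on \<open>p\<close> and
  \<open>\<kappa>\<close> apply at the next step.\<close>

lemma path_law_support:
  assumes "x \<in> X" "t + n \<le> T"
  shows "finite (set_pmf (path_law p \<kappa> t x n)) \<and>
    (\<forall>(S, \<alpha>)\<in>set_pmf (path_law p \<kappa> t x n). S (t + n) \<in> X)"
  using assms(2)
proof (induction n)
  case 0
  then show ?case using assms(1) by simp
next
  case (Suc n)
  then have IH: "finite (set_pmf (path_law p \<kappa> t x n))"
    "\<And>S \<alpha>. (S, \<alpha>) \<in> set_pmf (path_law p \<kappa> t x n) \<Longrightarrow> S (t + n) \<in> X" and t: "t + n < T"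
    by auto
  have fin: "finite (set_pmf (p (t + n) s))" "a \<in> set_pmf (p (t + n) s) \<Longrightarrow> finite (set_pmf (\<kappa> (t + n) s a))"
    if "s \<in> X" for s a
    using that p[OF t that] \<kappa>[OF t that] finA finX by (auto intro: finite_subset)
  show ?case
    using IH fin p[OF t] \<kappa>[OF t] by (fastforce simp: split_beta)
qed

text \<open>Collected reward plus value to go keeps its mean at every step, as a martingale does. At
  \<open>n = 0\<close> the mean is the backward value, at \<open>n = T - t\<close> the expected
  reward.\<close>

lemma expectation_path_law_reward:
  assumes "x \<in> X" "t + n \<le> T"
  shows "measure_pmf.expectation (path_law p \<kappa> t x n)
      (\<lambda>(S, \<alpha>). (\<Sum>l=t..<t + n. f l (S l) (\<alpha> l) (S (Suc l))) +
        backward_value X A T f g p (\<lambda>l x a. {\<kappa> l x a}) (T - (t + n)) (S (t + n)))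
    = backward_value X A T f g p (\<lambda>l x a. {\<kappa> l x a}) (T - t) x"
  using assms(2)
proof (induction n)
  case 0
  then show ?case by simp
next
  case (Suc n)
  let ?J = "backward_value X A T f g p (\<lambda>l x a. {\<kappa> l x a})"
  let ?M = "path_law p \<kappa> t x n"
  define h where "h n = (\<lambda>(S, \<alpha>). (\<Sum>l=t..<t + n. f l (S l) (\<alpha> l) (S (Suc l))) +
        ?J (T - (t + n)) (S (t + n)))" for n
  have t: "t + n < T" using Suc.prems by simp
  \<comment> \<open>\<open>m\<close> counts the steps left after the next one, and
    \<open>T - Suc m\<close> is the time \<open>t + n\<close> at which \<open>backward_value\<close>
    evaluates that step.\<close>
  obtain m where m: "T - Suc (t + n) = m" "T - (t + n) = Suc m" "T - Suc m = t + n"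
    using t by (metis Suc_diff_Suc diff_diff_cancel less_or_eq_imp_le)
  have M: "finite (set_pmf ?M)" "\<And>S \<alpha>. (S, \<alpha>) \<in> set_pmf ?M \<Longrightarrow> S (t + n) \<in> X"
    using path_law_support[OF assms(1), of t n] t by auto
  define N where "N = (\<lambda>(S, \<alpha>). bind_pmf (p (t + n) (S (t + n))) (\<lambda>b.
          map_pmf (\<lambda>y. (S(Suc (t + n) := y), \<alpha>(t + n := b))) (\<kappa> (t + n) (S (t + n)) b)))"
  have N: "finite (set_pmf (N z)) \<and> measure_pmf.expectation (N z) (h (Suc n)) = h n z" if "z \<in> set_pmf ?M" for z
  proof -
    obtain S \<alpha> where z: "z = (S, \<alpha>)" by (cases z)
    define s where "s = S (t + n)"
    define C where "C = (\<Sum>l=t..<t + n. f l (S l) (\<alpha> l) (S (Suc l)))"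
    have s: "s \<in> X" using M that by (simp add: z s_def)
    have fin: "finite (set_pmf (\<kappa> (t + n) s b))" if "b \<in> A" for b
      using \<kappa>[OF t s that] finX by (rule finite_subset)
    \<comment> \<open>The past reward \<open>C\<close> reads states up to \<open>t + n\<close> and
      actions before \<open>t + n\<close>, so the two overwritten coordinates do not affect
      it.\<close>
    have upd: "h (Suc n) (S(Suc (t + n) := y), \<alpha>(t + n := b)) = C + (f (t + n) s b y + ?J m y)" for b y
      by (simp add: h_def C_def s_def m)
    have "measure_pmf.expectation (N z) (h (Suc n)) =
        (\<Sum>b\<in>A. pmf (p (t + n) s) b * (\<Sum>y\<in>X. pmf (\<kappa> (t + n) s b) y * (C + (f (t + n) s b y + ?J m y))))"
      unfolding N_def z s_def[symmetric] prod.case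
      using finA p[OF t s] fin \<kappa>[OF t s] finX
      by (subst expectation_bind_finite[of A])
        (auto simp: upd expectation_finite_support[of X] intro!: sum.cong)
    also have "\<dots> = (\<Sum>b\<in>A. pmf (p (t + n) s) b * (C + (\<Sum>y\<in>X. pmf (\<kappa> (t + n) s b) y * (f (t + n) s b y + ?J m y))))"
      using sum_pmf_affine[OF finX \<kappa>[OF t s]] by (intro sum.cong) auto
    also have "\<dots> = C + (\<Sum>b\<in>A. pmf (p (t + n) s) b * (\<Sum>y\<in>X. pmf (\<kappa> (t + n) s b) y * (f (t + n) s b y + ?J m y)))"
      by (rule sum_pmf_affine[OF finA p[OF t s]])
    also have "\<dots> = C + ?J (Suc m) s" by (simp add: m(3))
    also have "\<dots> = h n z" by (simp add: h_def z C_def s_def m(2))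
    finally have "measure_pmf.expectation (N z) (h (Suc n)) = h n z" .
    moreover have "finite (set_pmf (N z))"
      using p[OF t s] fin finite_subset[OF p[OF t s] finA]
      by (auto simp: N_def z s_def[symmetric] intro!: finite_imageI)
    ultimately show ?thesis by simp
  qed
  have "path_law p \<kappa> t x (Suc n) = bind_pmf ?M N" by (simp add: N_def)
  then have "measure_pmf.expectation (path_law p \<kappa> t x (Suc n)) (h (Suc n)) = measure_pmf.expectation ?M (h n)"
    using M(1) N by (simp add: expectation_bind_finite[of "set_pmf ?M"] expectation_finite_support[of "set_pmf ?M"])
  also have "\<dots> = ?J (T - t) x" using Suc by (simp add: h_def)
  finally show ?case by (simp only: h_def)
qed

lemma expected_reward_eq_backward_value:
  assumes "x \<in> X" "t \<le> T"
  shows "expected_reward T f g p \<kappa> t x = backward_value X A T f g p (\<lambda>l x a. {\<kappa> l x a}) (T - t) x"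
  using expectation_path_law_reward[OF assms(1), of t "T - t" f g] assms(2) by (simp add: expected_reward_def)

end

section \<open>Selection of minimizing kernels\<close>

context
  fixes X :: "'s set" and A :: "'a set" and T :: nat and K :: "nat \<Rightarrow> 's \<Rightarrow> 'a \<Rightarrow> 's pmf set"
  assumes attained: "\<And>l x a H. l < T \<Longrightarrow> x \<in> X \<Longrightarrow> a \<in> A \<Longrightarrow>
    \<exists>P\<in>K l x a. \<forall>P'\<in>K l x a. (\<Sum>y\<in>X. pmf P y * H y) \<le> (\<Sum>y\<in>X. pmf P' y * H y)"
begin

text \<open>A real infimum is a lower bound only for sets bounded below; the attained minimum
  provides the bound.\<close>

lemma INF_le_of_attained:
  assumes "l < T" "x \<in> X" "a \<in> A" "P \<in> K l x a"
  shows "(INF P\<in>K l x a. \<Sum>y\<in>X. pmf P y * H y) \<le> (\<Sum>y\<in>X. pmf P y * H y)"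
proof -
  obtain m where "\<forall>P'\<in>K l x a. m \<le> (\<Sum>y\<in>X. pmf P' y * H y)" using attained[OF assms(1-3), of H] by blast
  then show ?thesis using assms(4) by (intro cINF_lower bdd_belowI2) auto
qed

lemma backward_value_mono:
  assumes "\<And>l x a. l < T \<Longrightarrow> x \<in> X \<Longrightarrow> a \<in> A \<Longrightarrow> \<kappa> l x a \<in> K l x a" "n \<le> T" "x \<in> X"
  shows "backward_value X A T f g p K n x \<le> backward_value X A T f g p (\<lambda>l x a. {\<kappa> l x a}) n x"
  using assms(2,3)
proof (induction n arbitrary: x)
  case (Suc n)
  define l where "l = T - Suc n"
  have l: "l < T" using Suc.prems by (simp add: l_def)
  have "(INF P\<in>K l x a. \<Sum>y\<in>X. pmf P y * (f l x a y + backward_value X A T f g p K n y))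
      \<le> (\<Sum>y\<in>X. pmf (\<kappa> l x a) y * (f l x a y + backward_value X A T f g p (\<lambda>l x a. {\<kappa> l x a}) n y))"
    if "a \<in> A" for a
  proof -
    have "(INF P\<in>K l x a. \<Sum>y\<in>X. pmf P y * (f l x a y + backward_value X A T f g p K n y))
        \<le> (\<Sum>y\<in>X. pmf (\<kappa> l x a) y * (f l x a y + backward_value X A T f g p K n y))"
      using l Suc.prems that assms(1) by (intro INF_le_of_attained) auto
    also have "\<dots> \<le> (\<Sum>y\<in>X. pmf (\<kappa> l x a) y * (f l x a y + backward_value X A T f g p (\<lambda>l x a. {\<kappa> l x a}) n y))"
      using Suc.prems by (intro sum_mono mult_left_mono add_left_mono Suc.IH) auto
    finally show ?thesis .
  qed
  then show ?case
    unfolding backward_value.simps l_def[symmetric] by (intro sum_mono mult_left_mono) simp_all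
qed simp

text \<open>The sets \<open>K l x a\<close> are chosen independently of each other (rectangularity),
  so minimizers picked separately for each triple assemble into one kernel that is optimal for all
  starting states and times at once.\<close>

lemma backward_value_attained:
  obtains \<kappa> where "\<And>l x a. l < T \<Longrightarrow> x \<in> X \<Longrightarrow> a \<in> A \<Longrightarrow> \<kappa> l x a \<in> K l x a"
    "\<And>n x. n \<le> T \<Longrightarrow> x \<in> X \<Longrightarrow>
      backward_value X A T f g p (\<lambda>l x a. {\<kappa> l x a}) n x = backward_value X A T f g p K n x"
proof -
  \<comment> \<open>After the step at time \<open>l\<close> there remain \<open>T - Suc l\<close>
    steps. The continuation is the already minimized value, so the choice at \<open>l\<close> does
    not refer to later choices.\<close>
  let ?H = "\<lambda>l x a y. f l x a y + backward_value X A T f g p K (T - Suc l) y"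
  define best where "best l x a P \<longleftrightarrow> P \<in> K l x a \<and>
    (\<forall>P'\<in>K l x a. (\<Sum>y\<in>X. pmf P y * ?H l x a y) \<le> (\<Sum>y\<in>X. pmf P' y * ?H l x a y))" for l x a P
  define \<kappa> where "\<kappa> l x a = (SOME P. best l x a P)" for l x a
  have best: "best l x a (\<kappa> l x a)" if "l < T" "x \<in> X" "a \<in> A" for l x a
  proof -
    have "\<exists>P. best l x a P" using attained[OF that, of "?H l x a"] by (auto simp: best_def)
    then show ?thesis unfolding \<kappa>_def by (rule someI_ex)
  qed
  have \<kappa>: "\<kappa> l x a \<in> K l x a"
    "P' \<in> K l x a \<Longrightarrow> (\<Sum>y\<in>X. pmf (\<kappa> l x a) y * ?H l x a y) \<le> (\<Sum>y\<in>X. pmf P' y * ?H l x a y)"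
    if "l < T" "x \<in> X" "a \<in> A" for l x a P'
    using best[OF that] by (auto simp: best_def)
  have "backward_value X A T f g p (\<lambda>l x a. {\<kappa> l x a}) n x = backward_value X A T f g p K n x"
    if "n \<le> T" "x \<in> X" for n x
    using that
  proof (induction n arbitrary: x)
    case (Suc n)
    define l where "l = T - Suc n"
    have l: "l < T" "T - Suc l = n" using Suc.prems by (auto simp: l_def)
    have "(INF P\<in>K l x a. \<Sum>y\<in>X. pmf P y * ?H l x a y) = (\<Sum>y\<in>X. pmf (\<kappa> l x a) y * ?H l x a y)"
      if "a \<in> A" for a
      using \<kappa>(1)[OF l(1) Suc.prems(2) that] \<kappa>(2)[OF l(1) Suc.prems(2) that]
      by (intro cInf_eq_minimum) auto
    then show ?case using Suc l by (simp add: l_def[symmetric])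
  qed simp
  with \<kappa>(1) that show ?thesis by blast
qed

end

section \<open>Bellman equation of the robust value\<close>

context
  fixes X :: "'s::real_normed_vector set" and A :: "'a set" and T q :: nat and \<epsilon> :: real
    and P0 :: "nat \<Rightarrow> 's \<Rightarrow> 'a \<Rightarrow> 's pmf" and p :: "nat \<Rightarrow> 's \<Rightarrow> 'a pmf"
  assumes finX: "finite X" and finA: "finite A" and q: "1 \<le> q" and \<epsilon>: "0 \<le> \<epsilon>"
    and P0: "\<And>t x a. t < T \<Longrightarrow> x \<in> X \<Longrightarrow> a \<in> A \<Longrightarrow> set_pmf (P0 t x a) \<subseteq> X"
    and p: "\<And>t x. t < T \<Longrightarrow> x \<in> X \<Longrightarrow> set_pmf (p t x) \<subseteq> A"
begin

text \<open>Interchange of infimum and expectation: every admissible kernel costs at least the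
  backward value, and the assembled minimizers are an admissible kernel attaining it.\<close>

lemma robust_value_eq_backward_value:
  assumes "x \<in> X" "t \<le> T"
  shows "robust_value q \<epsilon> X A T f g P0 p t x =
    backward_value X A T f g p (\<lambda>l x a. wasserstein_ball q \<epsilon> X (P0 l x a)) (T - t) x"
proof -
  let ?K = "\<lambda>l x a. wasserstein_ball q \<epsilon> X (P0 l x a)"
  have att: "\<exists>P\<in>?K l x a. \<forall>P'\<in>?K l x a. (\<Sum>y\<in>X. pmf P y * H y) \<le> (\<Sum>y\<in>X. pmf P' y * H y)"
    if l: "l < T" "x \<in> X" "a \<in> A" for l x a H
  proof -
    obtain Q where Q: "finite Q" "Q \<noteq> {}" "Q \<subseteq> ?K l x a" and min:
      "\<And>P H. P \<in> ?K l x a \<Longrightarrow> \<exists>P'\<in>Q. (\<Sum>y\<in>X. pmf P' y * H y) \<le> (\<Sum>y\<in>X. pmf P y * H y)"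
      using finite_minimizing_laws[OF finX P0[OF l] q \<epsilon>] by blast
    let ?L = "\<lambda>P. \<Sum>y\<in>X. pmf P y * H y"
    obtain P where P: "P \<in> Q" "\<And>P'. P' \<in> Q \<Longrightarrow> ?L P \<le> ?L P'"
      using arg_min_if_finite(1)[OF Q(1,2), of ?L] arg_min_least[OF Q(1,2), of _ ?L] by blast
    have "?L P \<le> ?L P'" if "P' \<in> ?K l x a" for P'
      using min[OF that, of H] P(2) by (auto intro: order_trans)
    then show ?thesis using P(1) Q(3) by blast
  qed
  have supp: "set_pmf (\<kappa> l x a) \<subseteq> X"
    if "\<kappa> \<in> ambiguity_kernels q \<epsilon> X A T P0" "l < T" "x \<in> X" "a \<in> A" for \<kappa> l x a
    using that by (auto simp: ambiguity_kernels_def wasserstein_ball_def)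
  have reward: "expected_reward T f g p \<kappa> t x = backward_value X A T f g p (\<lambda>l x a. {\<kappa> l x a}) (T - t) x"
    if "\<kappa> \<in> ambiguity_kernels q \<epsilon> X A T P0" for \<kappa>
    by (rule expected_reward_eq_backward_value[OF finX finA p supp[OF that] assms])
  obtain \<kappa> where \<kappa>: "\<And>l x a. l < T \<Longrightarrow> x \<in> X \<Longrightarrow> a \<in> A \<Longrightarrow> \<kappa> l x a \<in> ?K l x a"
    "\<And>n x. n \<le> T \<Longrightarrow> x \<in> X \<Longrightarrow>
      backward_value X A T f g p (\<lambda>l x a. {\<kappa> l x a}) n x = backward_value X A T f g p ?K n x"
    using backward_value_attained[where K = ?K, OF att] by blast
  have amb: "\<kappa> \<in> ambiguity_kernels q \<epsilon> X A T P0" using \<kappa>(1) by (simp add: ambiguity_kernels_def)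
  show ?thesis
    unfolding robust_value_def
  proof (rule cInf_eq_minimum)
    show "backward_value X A T f g p ?K (T - t) x
        \<in> (\<lambda>\<kappa>. expected_reward T f g p \<kappa> t x) ` ambiguity_kernels q \<epsilon> X A T P0"
      using amb reward[OF amb] \<kappa>(2)[OF diff_le_self assms(1)] by (intro image_eqI[of _ _ \<kappa>]) auto
    fix v assume "v \<in> (\<lambda>\<kappa>. expected_reward T f g p \<kappa> t x) ` ambiguity_kernels q \<epsilon> X A T P0"
    then obtain \<kappa>' where \<kappa>': "\<kappa>' \<in> ambiguity_kernels q \<epsilon> X A T P0" "v = expected_reward T f g p \<kappa>' t x"
      by blast
    then show "backward_value X A T f g p ?K (T - t) x \<le> v"
      using backward_value_mono[where K = ?K and \<kappa> = \<kappa>', OF att _ diff_le_self assms(1)] reward[OF \<kappa>'(1)]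
      by (simp add: ambiguity_kernels_def)
  qed
qed

lemma robust_value_terminal:
  assumes "x \<in> X"
  shows "robust_value q \<epsilon> X A T f g P0 p T x = g x"
  using robust_value_eq_backward_value[OF assms order_refl] by simp

lemma robust_value_step:
  assumes "x \<in> X" "t < T"
  shows "robust_value q \<epsilon> X A T f g P0 p t x =
    (\<Sum>a\<in>A. pmf (p t x) a * robust_action_value q \<epsilon> X A T f g P0 p t x a)"
proof -
  have T: "T - t = Suc (T - Suc t)" "T - Suc (T - Suc t) = t" using assms by auto
  show ?thesis
    using assms robust_value_eq_backward_value[of _ "Suc t"]
    by (simp add: robust_value_eq_backward_value T robust_action_value_def del: diff_Suc_Suc cong: sum.cong)
qed

end

section \<open>One-sided derivatives\<close>

lemma tendsto_Min_image:
  fixes \<phi> :: "'i \<Rightarrow> 'b \<Rightarrow> real"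
  assumes "finite Q" "Q \<noteq> {}" "\<And>w. w \<in> Q \<Longrightarrow> (\<phi> w \<longlongrightarrow> l w) F"
  shows "((\<lambda>h. Min ((\<lambda>w. \<phi> w h) ` Q)) \<longlongrightarrow> Min (l ` Q)) F"
  using assms
proof (induction Q rule: finite_ne_induct)
  case (insert w Q)
  then show ?case by (auto intro!: tendsto_min)
qed simp

text \<open>Near \<open>0\<close> only the members that are minimal at \<open>0\<close> compete for the minimum.\<close>

lemma has_right_derivative_Min:
  fixes \<phi> :: "'i \<Rightarrow> real \<Rightarrow> real"
  assumes Q: "finite Q" "Q \<noteq> {}"
    and d: "\<And>w. w \<in> Q \<Longrightarrow> (\<phi> w has_real_derivative d w) (at_right 0)"
  shows "((\<lambda>h. Min ((\<lambda>w. \<phi> w h) ` Q)) has_real_derivative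
    Min (d ` {w \<in> Q. \<forall>w'\<in>Q. \<phi> w 0 \<le> \<phi> w' 0})) (at_right 0)"
proof -
  define B where "B = {w \<in> Q. \<forall>w'\<in>Q. \<phi> w 0 \<le> \<phi> w' 0}"
  define m where "m h = Min ((\<lambda>w. \<phi> w h) ` Q)" for h
  have "m 0 \<in> (\<lambda>w. \<phi> w 0) ` Q" unfolding m_def using Q by (intro Min_in) auto
  then obtain b where b: "b \<in> Q" "m 0 = \<phi> b 0" by blast
  have m0: "m 0 \<le> \<phi> w 0" if "w \<in> Q" for w using that Q by (simp add: m_def)
  have B: "B = {w \<in> Q. \<phi> w 0 = m 0}" using b m0 by (fastforce simp: B_def)
  have finB: "finite B" "B \<noteq> {}" using Q b by (auto simp: B)
  have lim: "(\<phi> w \<longlongrightarrow> \<phi> w 0) (at_right 0)" if "w \<in> Q" for w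
    using DERIV_continuous[OF d[OF that]] by (simp add: continuous_within)
  have "\<forall>\<^sub>F h in at_right 0. \<forall>w\<in>Q - B. \<phi> b h < \<phi> w h"
  proof (intro eventually_ball_finite ballI)
    fix w assume w: "w \<in> Q - B"
    then have "\<phi> b 0 < \<phi> w 0" using m0[of w] b by (auto simp: B)
    then have "0 < \<phi> w 0 - \<phi> b 0" by simp
    moreover have "((\<lambda>h. \<phi> w h - \<phi> b h) \<longlongrightarrow> \<phi> w 0 - \<phi> b 0) (at_right 0)"
      using w b by (intro tendsto_diff lim) auto
    ultimately have "\<forall>\<^sub>F h in at_right 0. 0 < \<phi> w h - \<phi> b h" by (rule order_tendstoD(1)[rotated])
    then show "\<forall>\<^sub>F h in at_right 0. \<phi> b h < \<phi> w h" by (rule eventually_mono) simp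
  qed (use Q in auto)
  moreover have "\<forall>\<^sub>F h::real in at_right 0. 0 < h" by (simp add: eventually_at_right_less)
  ultimately have ev: "\<forall>\<^sub>F h in at_right 0. Min ((\<lambda>w. (\<phi> w h - \<phi> w 0) / (h - 0)) ` B) = (m h - m 0) / (h - 0)"
  proof eventually_elim
    case (elim h)
    have "m h = Min ((\<lambda>w. \<phi> w h) ` B)"
      unfolding m_def
    proof (rule Min_eqI)
      show "Min ((\<lambda>w. \<phi> w h) ` B) \<in> (\<lambda>w. \<phi> w h) ` Q"
      proof -
        have "Min ((\<lambda>w. \<phi> w h) ` B) \<in> (\<lambda>w. \<phi> w h) ` B" using finB by (intro Min_in) auto
        then show ?thesis by (auto simp: B_def)
      qed
      have bB: "b \<in> B" using b by (simp add: B)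
      fix v assume "v \<in> (\<lambda>w. \<phi> w h) ` Q"
      then obtain w where w: "w \<in> Q" "v = \<phi> w h" by blast
      show "Min ((\<lambda>w. \<phi> w h) ` B) \<le> v"
      proof (cases "w \<in> B")
        case True
        then show ?thesis using finB w by (auto intro!: Min_le)
      next
        case False
        have "Min ((\<lambda>w. \<phi> w h) ` B) \<le> \<phi> b h" using finB bB by (auto intro!: Min_le)
        also have "\<phi> b h < \<phi> w h" using False elim(1) w(1) by blast
        finally show ?thesis using w(2) by simp
      qed
    qed (use Q in auto)
    \<comment> \<open>For \<open>h > 0\<close> the difference quotient is increasing in its first
      value and so commutes with \<open>Min\<close>. All members of \<open>B\<close> start at
      \<open>m 0\<close>, hence the quotient of the minimum is the minimum of their own
      quotients.\<close>
    moreover have "mono (\<lambda>v. (v - m 0) / (h - 0))" using elim(2) by (intro monoI divide_right_mono) auto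
    ultimately have "(m h - m 0) / (h - 0) = Min ((\<lambda>v. (v - m 0) / (h - 0)) ` (\<lambda>w. \<phi> w h) ` B)"
      using finB mono_Min_commute[of "\<lambda>v. (v - m 0) / (h - 0)" "(\<lambda>w. \<phi> w h) ` B"] by simp
    also have "(\<lambda>v. (v - m 0) / (h - 0)) ` (\<lambda>w. \<phi> w h) ` B = (\<lambda>w. (\<phi> w h - \<phi> w 0) / (h - 0)) ` B"
      unfolding image_image by (rule image_cong) (auto simp: B)
    finally show ?case ..
  qed
  have "((\<lambda>h. Min ((\<lambda>w. (\<phi> w h - \<phi> w 0) / (h - 0)) ` B)) \<longlongrightarrow> Min (d ` B)) (at_right 0)"
    using d finB by (intro tendsto_Min_image) (auto simp: B_def has_field_derivative_iff)
  then have "((\<lambda>h. (m h - m 0) / (h - 0)) \<longlongrightarrow> Min (d ` B)) (at_right 0)"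
    by (rule Lim_transform_eventually[OF _ ev])
  then show ?thesis by (simp add: has_field_derivative_iff m_def B_def)
qed

lemma right_derivative_nonneg:
  fixes F :: "real \<Rightarrow> real"
  assumes "(F has_real_derivative d) (at_right 0)" "\<And>h. F 0 \<le> F h"
  shows "0 \<le> d"
proof (rule tendsto_lowerbound)
  show "((\<lambda>h. (F h - F 0) / (h - 0)) \<longlongrightarrow> d) (at_right 0)"
    using assms(1) by (simp add: has_field_derivative_iff)
  have "\<forall>\<^sub>F h::real in at_right 0. 0 < h" by (simp add: eventually_at_right_less)
  then show "\<forall>\<^sub>F h in at_right 0. 0 \<le> (F h - F 0) / (h - 0)"
    by eventually_elim (use assms(2) in simp)
qed simp

text \<open>Danskin's formula along a ray. Only a right derivative of \<open>v\<close> at 0 is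
  assumed, because \<open>v\<close> will be the next value function, which may itself have
  kinks.\<close>

lemma robust_expectation_right_derivative:
  fixes X :: "'s::real_normed_vector set" and v :: "real \<Rightarrow> 's \<Rightarrow> real"
  assumes X: "finite X" "set_pmf \<mu> \<subseteq> X" "1 \<le> q" "0 \<le> \<epsilon>"
    and d: "\<And>y. y \<in> X \<Longrightarrow> ((\<lambda>h. v h y) has_real_derivative d y) (at_right 0)"
  obtains e where
    "((\<lambda>h. INF P\<in>wasserstein_ball q \<epsilon> X \<mu>. \<Sum>y\<in>X. pmf P y * (c y + v h y)) has_real_derivative e) (at_right 0)"
    "is_minimum_of e ((\<lambda>P. \<Sum>y\<in>X. pmf P y * d y) ` worst_case_laws q \<epsilon> X \<mu> (\<lambda>y. c y + v 0 y))"
proof -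
  let ?\<phi> = "\<lambda>P h. \<Sum>y\<in>X. pmf P y * (c y + v h y)" and ?d = "\<lambda>P. \<Sum>y\<in>X. pmf P y * d y"
  let ?ball = "wasserstein_ball q \<epsilon> X \<mu>"
  let ?worst = "worst_case_laws q \<epsilon> X \<mu> (\<lambda>y. c y + v 0 y)"
  obtain Q where Q: "finite Q" "Q \<noteq> {}" "Q \<subseteq> ?ball"
    and min: "\<And>P H. P \<in> ?ball \<Longrightarrow> \<exists>P'\<in>Q. (\<Sum>y\<in>X. pmf P' y * H y) \<le> (\<Sum>y\<in>X. pmf P y * H y)"
    using finite_minimizing_laws[OF X] by blast
  define m where "m h = Min ((\<lambda>P. ?\<phi> P h) ` Q)" for h
  have m_in: "m h \<in> (\<lambda>P. ?\<phi> P h) ` Q" for h unfolding m_def using Q by (intro Min_in) auto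
  have m_le_Q: "m h \<le> ?\<phi> P h" if "P \<in> Q" for P h unfolding m_def using Q that by (intro Min_le) auto
  have m_le: "m h \<le> ?\<phi> P h" if P: "P \<in> ?ball" for P h
  proof -
    obtain P' where P': "P' \<in> Q" "?\<phi> P' h \<le> ?\<phi> P h" using min[OF P, of "\<lambda>y. c y + v h y"] by blast
    from m_le_Q[OF P'(1)] P'(2) show ?thesis by (rule order_trans)
  qed
  have INF: "(INF P\<in>?ball. ?\<phi> P h) = m h" for h
  proof (rule cInf_eq_minimum)
    show "m h \<in> (\<lambda>P. ?\<phi> P h) ` ?ball" using m_in[of h] Q(3) by blast
  qed (use m_le in blast)
  define B where "B = {w \<in> Q. \<forall>w'\<in>Q. ?\<phi> w 0 \<le> ?\<phi> w' 0}"
  have \<phi>': "(?\<phi> P has_real_derivative ?d P) (at_right 0)" for P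
    using d by (auto intro!: derivative_eq_intros simp: mult.commute)
  have m': "(m has_real_derivative Min (?d ` B)) (at_right 0)"
    unfolding m_def B_def by (rule has_right_derivative_Min[OF Q(1,2) \<phi>'])
  have B: "B = {P \<in> Q. ?\<phi> P 0 = m 0}"
    using m_in[of 0] m_le_Q[of _ 0] by (fastforce simp: B_def)
  have worst: "?worst = {P \<in> ?ball. ?\<phi> P 0 = m 0}"
    using m_in[of 0] Q(3) m_le[of _ 0] by (fastforce simp: worst_case_laws_def is_arg_min_linorder)
  have "Min (?d ` B) \<in> ?d ` B"
    using m_in[of 0] Q by (intro Min_in) (auto simp: B)
  then have "Min (?d ` B) \<in> ?d ` ?worst" using Q(3) unfolding B worst by blast
  \<comment> \<open>A worst-case law need not belong to \<open>Q\<close>. Its gap to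
    \<open>m\<close> is nonnegative and vanishes at 0, so the gap has a nonnegative right
    derivative.\<close>
  moreover have "Min (?d ` B) \<le> ?d P" if "P \<in> ?worst" for P
  proof -
    have "((\<lambda>h. ?\<phi> P h - m h) has_real_derivative ?d P - Min (?d ` B)) (at_right 0)"
      by (rule DERIV_diff[OF \<phi>' m'])
    then have "0 \<le> ?d P - Min (?d ` B)"
      using that m_le[of P] unfolding worst by (intro right_derivative_nonneg) auto
    then show ?thesis by simp
  qed
  ultimately have "is_minimum_of (Min (?d ` B)) (?d ` ?worst)" by (auto simp: is_minimum_of_def)
  with m' show ?thesis unfolding INF[symmetric] by (intro that)
qed

section \<open>Directional derivatives, gradients and scores\<close>

lemma tendsto_diff_quotient_iff:
  "(diff_quotient F \<theta> r \<longlongrightarrow> d) (at_right 0) \<longleftrightarrow>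
    ((\<lambda>h. F (\<theta> + h *\<^sub>R r)) has_real_derivative d) (at_right 0)"
  by (simp add: has_field_derivative_iff diff_quotient_def[abs_def])

lemma dir_deriv_rightI:
  assumes "((\<lambda>h. F (\<theta> + h *\<^sub>R r)) has_real_derivative d) (at_right 0)"
  shows "dir_deriv_right_exists F \<theta> r" "dir_deriv_right F \<theta> r = d"
  using assms unfolding tendsto_diff_quotient_iff[symmetric] dir_deriv_right_exists_def dir_deriv_right_def
  by (auto intro: tendsto_Lim)

lemma dir_deriv_leftI:
  assumes "((\<lambda>h. F (\<theta> + h *\<^sub>R (- r))) has_real_derivative d) (at_right 0)"
  shows "dir_deriv_left_exists F \<theta> r" "dir_deriv_left F \<theta> r = - d"
proof -
  have "diff_quotient F \<theta> r (- h) = - diff_quotient F \<theta> (- r) h" for h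
    by (simp add: diff_quotient_def)
  then have "(diff_quotient F \<theta> r \<longlongrightarrow> - d) (at_left 0)"
    using assms unfolding tendsto_diff_quotient_iff[symmetric] filterlim_at_left_to_right
    by (auto intro!: tendsto_minus)
  then show "dir_deriv_left_exists F \<theta> r" "dir_deriv_left F \<theta> r = - d"
    by (auto simp: dir_deriv_left_exists_def dir_deriv_left_def intro: tendsto_Lim)
qed

lemma gradient_eqI:
  assumes "(F has_derivative (\<lambda>h. h \<bullet> D)) (at \<theta>)"
  shows "gradient F \<theta> = D"
  unfolding gradient_def gderiv_def
proof (rule the_equality)
  show "(F has_derivative (\<lambda>h. h \<bullet> D)) (at \<theta>)" by (rule assms)
  fix D' assume "(F has_derivative (\<lambda>h. h \<bullet> D')) (at \<theta>)"
  then have "(\<lambda>h. h \<bullet> D') = (\<lambda>h. h \<bullet> D)" using assms by (rule has_derivative_unique)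
  \<comment> \<open>Testing the equal linear forms on \<open>D' - D\<close> makes its norm
    vanish.\<close>
  then have "(D' - D) \<bullet> D' = (D' - D) \<bullet> D" by metis
  then have "(D' - D) \<bullet> (D' - D) = 0" by (simp only: inner_diff_right)
  then show "D' = D" by simp
qed

lemma eventually_at_right_line_in_interior:
  fixes \<theta> r :: "'p::real_normed_vector"
  assumes "\<theta> \<in> interior \<Theta>"
  shows "\<forall>\<^sub>F h in at_right 0. \<theta> + h *\<^sub>R r \<in> \<Theta>"
proof -
  have "((\<lambda>h. \<theta> + h *\<^sub>R r) \<longlongrightarrow> \<theta> + 0 *\<^sub>R r) (at_right 0)" by (intro tendsto_intros)
  then have "\<forall>\<^sub>F h in at_right 0. \<theta> + h *\<^sub>R r \<in> interior \<Theta>"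
    using assms by (intro topological_tendstoD) auto
  then show ?thesis by (rule eventually_mono) (use interior_subset in blast)
qed

text \<open>Differentiates \<open>u\<close> as \<open>exp (ln u)\<close>, which holds on the
  parameter set, where \<open>u\<close> is positive; the ray stays there for small \<open>h\<close>.
  At an interior point the derivative within the set is the full one, so \<open>gradient\<close>
  picks out the score.\<close>

lemma score_right_derivative:
  fixes \<theta> r :: "'p::euclidean_space"
  assumes \<theta>: "\<theta> \<in> interior \<Theta>" and pos: "\<And>\<eta>. \<eta> \<in> \<Theta> \<Longrightarrow> 0 < u \<eta>"
    and s: "((\<lambda>\<eta>. ln (u \<eta>)) has_derivative (\<lambda>h. h \<bullet> s)) (at \<theta> within \<Theta>)"
  shows "((\<lambda>h. u (\<theta> + h *\<^sub>R r)) has_real_derivative u \<theta> * (gradient (\<lambda>\<eta>. ln (u \<eta>)) \<theta> \<bullet> r)) (at_right 0)"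
proof -
  have s': "((\<lambda>\<eta>. ln (u \<eta>)) has_derivative (\<lambda>h. h \<bullet> s)) (at (\<theta> + 0 *\<^sub>R r))"
    using s by (simp add: at_within_interior[OF \<theta>])
  have "((\<lambda>h::real. \<theta> + h *\<^sub>R r) has_derivative (\<lambda>h. h *\<^sub>R r)) (at_right 0)"
    by (auto intro!: derivative_eq_intros)
  from has_derivative_compose[OF this s']
  have "((\<lambda>h. ln (u (\<theta> + h *\<^sub>R r))) has_derivative (\<lambda>h. (h *\<^sub>R r) \<bullet> s)) (at_right 0)" .
  also have "(\<lambda>h. (h *\<^sub>R r) \<bullet> s) = (*) (s \<bullet> r)"
    by (simp add: fun_eq_iff inner_commute[of r s])
  finally have "((\<lambda>h. ln (u (\<theta> + h *\<^sub>R r))) has_real_derivative (s \<bullet> r)) (at_right 0)"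
    unfolding has_field_derivative_def .
  from DERIV_chain2[OF DERIV_exp this]
  have "((\<lambda>h. exp (ln (u (\<theta> + h *\<^sub>R r)))) has_real_derivative exp (ln (u \<theta>)) * (s \<bullet> r)) (at_right 0)"
    by simp
  moreover have "gradient (\<lambda>\<eta>. ln (u \<eta>)) \<theta> = s" using s' by (intro gradient_eqI) simp
  moreover have u: "0 < u \<theta>" using pos \<theta> interior_subset by blast
  ultimately have "((\<lambda>h. exp (ln (u (\<theta> + h *\<^sub>R r)))) has_real_derivative
      u \<theta> * (gradient (\<lambda>\<eta>. ln (u \<eta>)) \<theta> \<bullet> r)) (at_right 0)" by simp
  moreover have "\<forall>\<^sub>F h in at_right 0. exp (ln (u (\<theta> + h *\<^sub>R r))) = u (\<theta> + h *\<^sub>R r)"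
    using eventually_at_right_line_in_interior[OF \<theta>, of r] by (rule eventually_mono) (simp add: pos)
  ultimately show ?thesis
    using u by (subst (asm) has_field_derivative_cong_eventually) auto
qed

section \<open>Differentiating the Bellman recursion\<close>

theorem theorem3p2:
  fixes X :: "(real ^ 'd) set" and A :: "(real ^ 'm) set"
    and \<Theta> :: "(real ^ 'k) set"
    and T q :: nat and \<epsilon> :: real
    and f :: "nat \<Rightarrow> real ^ 'd \<Rightarrow> real ^ 'm \<Rightarrow> real ^ 'd \<Rightarrow> real"
    and g :: "real ^ 'd \<Rightarrow> real"
    and P0 :: "nat \<Rightarrow> real ^ 'd \<Rightarrow> real ^ 'm \<Rightarrow> (real ^ 'd) pmf"
    and \<pi> :: "real ^ 'k \<Rightarrow> nat \<Rightarrow> real ^ 'd \<Rightarrow> (real ^ 'm) pmf"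
    and \<theta> r :: "real ^ 'k"
  defines "V \<equiv> \<lambda>t \<eta> x. robust_value q \<epsilon> X A T f g P0 (\<pi> \<eta>) t x"
    and "G \<equiv> \<lambda>t \<eta> x a. robust_action_value q \<epsilon> X A T f g P0 (\<pi> \<eta>) t x a"
  defines "H \<equiv> \<lambda>t x a y. f t x a y + V (Suc t) \<theta> y"
  defines "Pstar \<equiv> \<lambda>t x a. worst_case_laws q \<epsilon> X (P0 t x a) (H t x a)"
  assumes "finite X" and "X \<noteq> {}" and "finite A" and "A \<noteq> {}"
    and "1 \<le> T" and "1 \<le> q" and "0 < \<epsilon>"
    and "\<forall>t<T. \<forall>x\<in>X. \<forall>a\<in>A. set_pmf (P0 t x a) \<subseteq> X"
    and "compact \<Theta>"
    and "\<forall>\<eta>\<in>\<Theta>. \<forall>t<T. \<forall>x\<in>X. set_pmf (\<pi> \<eta> t x) \<subseteq> A"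
    and "regular_policy_class \<Theta> T X A \<pi>"
    and "\<theta> \<in> interior \<Theta>"
  shows
    "(\<forall>t\<le>T. \<forall>x\<in>X.
        dir_deriv_right_exists (\<lambda>\<eta>. V t \<eta> x) \<theta> r \<and>
        dir_deriv_left_exists (\<lambda>\<eta>. V t \<eta> x) \<theta> r) \<and>
     (\<forall>x\<in>X.
        dir_deriv_right (\<lambda>\<eta>. V T \<eta> x) \<theta> r = 0 \<and>
        dir_deriv_left (\<lambda>\<eta>. V T \<eta> x) \<theta> r = 0) \<and>
     (\<forall>t<T. \<forall>x\<in>X.
        dir_deriv_right (\<lambda>\<eta>. V t \<eta> x) \<theta> r =
          (\<Sum>a\<in>A. pmf (\<pi> \<theta> t x) a *
            (G t \<theta> x a * (gradient (\<lambda>\<eta>. ln (pmf (\<pi> \<eta> t x) a)) \<theta> \<bullet> r)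
              + dir_deriv_right (\<lambda>\<eta>. G t \<eta> x a) \<theta> r)) \<and>
        dir_deriv_left (\<lambda>\<eta>. V t \<eta> x) \<theta> r =
          (\<Sum>a\<in>A. pmf (\<pi> \<theta> t x) a *
            (G t \<theta> x a * (gradient (\<lambda>\<eta>. ln (pmf (\<pi> \<eta> t x) a)) \<theta> \<bullet> r)
              + dir_deriv_left (\<lambda>\<eta>. G t \<eta> x a) \<theta> r))) \<and>
     (\<forall>t<T. \<forall>x\<in>X. \<forall>a\<in>A.
        dir_deriv_right_exists (\<lambda>\<eta>. G t \<eta> x a) \<theta> r \<and>
        dir_deriv_left_exists (\<lambda>\<eta>. G t \<eta> x a) \<theta> r \<and>
        is_minimum_of (dir_deriv_right (\<lambda>\<eta>. G t \<eta> x a) \<theta> r)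
          ((\<lambda>P. \<Sum>y\<in>X. pmf P y * dir_deriv_right (\<lambda>\<eta>. V (Suc t) \<eta> y) \<theta> r) ` Pstar t x a) \<and>
        is_maximum_of (dir_deriv_left (\<lambda>\<eta>. G t \<eta> x a) \<theta> r)
          ((\<lambda>P. \<Sum>y\<in>X. pmf P y * dir_deriv_left (\<lambda>\<eta>. V (Suc t) \<eta> y) \<theta> r) ` Pstar t x a)) \<and>
     (\<forall>t<T. \<forall>x\<in>X. \<forall>a\<in>A.
        polytope (pmf ` Pstar t x a) \<and>
        pmf ` Pstar t x a =
          second_marginal X ` transport_optimal q \<epsilon> X (P0 t x a) (H t x a))"
proof -
  note fin = \<open>finite X\<close> \<open>finite A\<close> and q = \<open>1 \<le> q\<close>
  have \<epsilon>: "0 \<le> \<epsilon>" using \<open>0 < \<epsilon>\<close> by simp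
  have P0: "set_pmf (P0 t x a) \<subseteq> X" if "t < T" "x \<in> X" "a \<in> A" for t x a
    using \<open>\<forall>t<T. \<forall>x\<in>X. \<forall>a\<in>A. set_pmf (P0 t x a) \<subseteq> X\<close> that by blast
  have \<pi>: "set_pmf (\<pi> \<eta> t x) \<subseteq> A" if "\<eta> \<in> \<Theta>" "t < T" "x \<in> X" for \<eta> t x
    using \<open>\<forall>\<eta>\<in>\<Theta>. \<forall>t<T. \<forall>x\<in>X. set_pmf (\<pi> \<eta> t x) \<subseteq> A\<close> that by blast
  note \<theta> = \<open>\<theta> \<in> interior \<Theta>\<close>
  have \<theta>\<Theta>: "\<theta> \<in> \<Theta>" using \<theta> interior_subset by blast
  obtain s C where score: "\<forall>\<theta>\<in>\<Theta>. \<forall>t<T. \<forall>x\<in>X. \<forall>a\<in>A.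
      0 < pmf (\<pi> \<theta> t x) a \<and>
      ((\<lambda>\<eta>. ln (pmf (\<pi> \<eta> t x) a)) has_derivative (\<lambda>h. h \<bullet> s \<theta> t x a)) (at \<theta> within \<Theta>) \<and>
      norm (s \<theta> t x a) \<le> (C::real)"
    using \<open>regular_policy_class \<Theta> T X A \<pi>\<close> unfolding regular_policy_class_def by blast
  let ?grad = "\<lambda>t x a. gradient (\<lambda>\<eta>. ln (pmf (\<pi> \<eta> t x) a)) \<theta>"
  \<comment> \<open>Policies are known to be supported in \<open>A\<close> only for parameters in
    \<open>\<Theta>\<close>, so the recursion is available only there.\<close>
  have V_T: "V T \<eta> x = g x" if "\<eta> \<in> \<Theta>" "x \<in> X" for \<eta> x
    unfolding V_def using fin q \<epsilon> P0 \<pi>[OF that(1)] that(2) by (rule robust_value_terminal)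
  have V_step: "V t \<eta> x = (\<Sum>a\<in>A. pmf (\<pi> \<eta> t x) a * G t \<eta> x a)"
    if "\<eta> \<in> \<Theta>" "x \<in> X" "t < T" for \<eta> t x
    unfolding V_def G_def using fin q \<epsilon> P0 \<pi>[OF that(1)] that(2,3) by (rule robust_value_step)

  \<comment> \<open>The direction \<open>u\<close> is arbitrary: \<open>r\<close> serves the right
    derivatives and \<open>- r\<close> the left ones.\<close>
  have G': "\<exists>e. ((\<lambda>h. G t (\<theta> + h *\<^sub>R u) x a) has_real_derivative e) (at_right 0) \<and>
      is_minimum_of e ((\<lambda>P. \<Sum>y\<in>X. pmf P y * d y) ` Pstar t x a)"
    if tx: "t < T" "x \<in> X" "a \<in> A"
      and d: "\<And>y. y \<in> X \<Longrightarrow> ((\<lambda>h. V (Suc t) (\<theta> + h *\<^sub>R u) y) has_real_derivative d y) (at_right 0)"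
    for t x a u d
  proof -
    obtain e where "((\<lambda>h. INF P\<in>wasserstein_ball q \<epsilon> X (P0 t x a).
          \<Sum>y\<in>X. pmf P y * (f t x a y + V (Suc t) (\<theta> + h *\<^sub>R u) y)) has_real_derivative e) (at_right 0)"
      "is_minimum_of e ((\<lambda>P. \<Sum>y\<in>X. pmf P y * d y) `
          worst_case_laws q \<epsilon> X (P0 t x a) (\<lambda>y. f t x a y + V (Suc t) (\<theta> + 0 *\<^sub>R u) y))"
      by (rule robust_expectation_right_derivative[OF fin(1) P0[OF tx] q \<epsilon>,
            where v = "\<lambda>h y. V (Suc t) (\<theta> + h *\<^sub>R u) y" and c = "f t x a" and d = d])
        (use d in auto)
    then show ?thesis by (auto simp: G_def robust_action_value_def V_def Pstar_def H_def)
  qed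

  have V': "((\<lambda>h. V t (\<theta> + h *\<^sub>R u) x) has_real_derivative
      (\<Sum>a\<in>A. pmf (\<pi> \<theta> t x) a * (G t \<theta> x a * (?grad t x a \<bullet> u) + e a))) (at_right 0)"
    if tx: "t < T" "x \<in> X"
      and e: "\<And>a. a \<in> A \<Longrightarrow> ((\<lambda>h. G t (\<theta> + h *\<^sub>R u) x a) has_real_derivative e a) (at_right 0)"
    for t x u e
  proof -
    have p: "((\<lambda>h. pmf (\<pi> (\<theta> + h *\<^sub>R u) t x) a) has_real_derivative
        pmf (\<pi> \<theta> t x) a * (?grad t x a \<bullet> u)) (at_right 0)" if "a \<in> A" for a
      using score tx that \<theta>\<Theta> by (intro score_right_derivative[OF \<theta>, where s = "s \<theta> t x a"]) auto
    have "((\<lambda>h. \<Sum>a\<in>A. pmf (\<pi> (\<theta> + h *\<^sub>R u) t x) a * G t (\<theta> + h *\<^sub>R u) x a) has_real_derivative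
        (\<Sum>a\<in>A. pmf (\<pi> \<theta> t x) a * (?grad t x a \<bullet> u) * G t (\<theta> + 0 *\<^sub>R u) x a
          + e a * pmf (\<pi> (\<theta> + 0 *\<^sub>R u) t x) a)) (at_right 0)"
      by (intro DERIV_sum DERIV_mult p e)
    then have "((\<lambda>h. \<Sum>a\<in>A. pmf (\<pi> (\<theta> + h *\<^sub>R u) t x) a * G t (\<theta> + h *\<^sub>R u) x a) has_real_derivative
        (\<Sum>a\<in>A. pmf (\<pi> \<theta> t x) a * (G t \<theta> x a * (?grad t x a \<bullet> u) + e a))) (at_right 0)"
      by (simp add: algebra_simps)
    moreover have "\<forall>\<^sub>F h in at_right 0. (\<Sum>a\<in>A. pmf (\<pi> (\<theta> + h *\<^sub>R u) t x) a * G t (\<theta> + h *\<^sub>R u) x a)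
        = V t (\<theta> + h *\<^sub>R u) x"
      using eventually_at_right_line_in_interior[OF \<theta>, of u]
      by (rule eventually_mono) (simp add: V_step tx)
    ultimately show ?thesis
      using V_step[OF \<theta>\<Theta> tx(2,1)] by (subst (asm) has_field_derivative_cong_eventually) auto
  qed

  have V_T': "((\<lambda>h. V T (\<theta> + h *\<^sub>R u) x) has_real_derivative 0) (at_right 0)" if "x \<in> X" for x u
  proof -
    have "\<forall>\<^sub>F h in at_right 0. g x = V T (\<theta> + h *\<^sub>R u) x"
      using eventually_at_right_line_in_interior[OF \<theta>, of u]
      by (rule eventually_mono) (simp add: V_T that)
    moreover have "((\<lambda>h. g x) has_real_derivative 0) (at_right 0)" by simp
    ultimately show ?thesis
      using V_T[OF \<theta>\<Theta> that] by (subst (asm) has_field_derivative_cong_eventually) auto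
  qed

  \<comment> \<open>Existence comes before the formulas: once the limits exist,
    \<open>dir_deriv_right\<close> names them, and each formula follows by uniqueness of
    limits.\<close>
  have ex: "\<exists>d. ((\<lambda>h. V t (\<theta> + h *\<^sub>R u) x) has_real_derivative d) (at_right 0)"
    if "t \<le> T" "x \<in> X" for t x u
    using that
  proof (induction t arbitrary: x rule: inc_induct)
    case base
    then show ?case using V_T' by blast
  next
    case (step t)
    then obtain d where
      "\<And>y. y \<in> X \<Longrightarrow> ((\<lambda>h. V (Suc t) (\<theta> + h *\<^sub>R u) y) has_real_derivative d y) (at_right 0)"
      by metis
    from G'[OF step.hyps(2) step.prems _ this] obtain e where
      "\<And>a. a \<in> A \<Longrightarrow> ((\<lambda>h. G t (\<theta> + h *\<^sub>R u) x a) has_real_derivative e a) (at_right 0)"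
      by metis
    from V'[OF step.hyps(2) step.prems this] show ?case by blast
  qed

  let ?dV = "\<lambda>u t x. dir_deriv_right (\<lambda>\<eta>. V t \<eta> x) \<theta> u"
    and ?dG = "\<lambda>u t x a. dir_deriv_right (\<lambda>\<eta>. G t \<eta> x a) \<theta> u"
  have dV: "((\<lambda>h. V t (\<theta> + h *\<^sub>R u) x) has_real_derivative ?dV u t x) (at_right 0)"
    if "t \<le> T" "x \<in> X" for t x u
    using ex[OF that, of u] dir_deriv_rightI(2)[of "\<lambda>\<eta>. V t \<eta> x"] by auto
  have dG: "((\<lambda>h. G t (\<theta> + h *\<^sub>R u) x a) has_real_derivative ?dG u t x a) (at_right 0)"
      "is_minimum_of (?dG u t x a) ((\<lambda>P. \<Sum>y\<in>X. pmf P y * ?dV u (Suc t) y) ` Pstar t x a)"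
    if "t < T" "x \<in> X" "a \<in> A" for t x a u
  proof -
    have "t' < T \<Longrightarrow> Suc t' \<le> T" for t' by simp
    from G'[OF that dV[OF this[OF that(1)]], of u]
    obtain e where e: "((\<lambda>h. G t (\<theta> + h *\<^sub>R u) x a) has_real_derivative e) (at_right 0)"
      "is_minimum_of e ((\<lambda>P. \<Sum>y\<in>X. pmf P y * ?dV u (Suc t) y) ` Pstar t x a)" by blast
    moreover have "?dG u t x a = e" using e(1) by (rule dir_deriv_rightI(2))
    ultimately show "((\<lambda>h. G t (\<theta> + h *\<^sub>R u) x a) has_real_derivative ?dG u t x a) (at_right 0)"
      "is_minimum_of (?dG u t x a) ((\<lambda>P. \<Sum>y\<in>X. pmf P y * ?dV u (Suc t) y) ` Pstar t x a)"
      by simp_all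
  qed
  have dV_step: "?dV u t x = (\<Sum>a\<in>A. pmf (\<pi> \<theta> t x) a * (G t \<theta> x a * (?grad t x a \<bullet> u) + ?dG u t x a))"
    if "t < T" "x \<in> X" for t x u
    using V'[OF that dG(1)[OF that]] by (rule dir_deriv_rightI(2))
  have dV_T: "?dV u T x = 0" if "x \<in> X" for x u
    using V_T'[OF that] by (rule dir_deriv_rightI(2))
  have left_V: "dir_deriv_left (\<lambda>\<eta>. V t \<eta> x) \<theta> r = - ?dV (- r) t x" if "t \<le> T" "x \<in> X" for t x
    using dV[OF that] by (rule dir_deriv_leftI(2))
  have left_G: "dir_deriv_left (\<lambda>\<eta>. G t \<eta> x a) \<theta> r = - ?dG (- r) t x a"
    if "t < T" "x \<in> X" "a \<in> A" for t x a
    using dG(1)[OF that] by (rule dir_deriv_leftI(2))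
  \<comment> \<open>Passing to \<open>- r\<close> flips the sign of both the score term and the
    derivative of \<open>G\<close>; the outer minus restores both.\<close>
  have left_step: "dir_deriv_left (\<lambda>\<eta>. V t \<eta> x) \<theta> r =
      (\<Sum>a\<in>A. pmf (\<pi> \<theta> t x) a * (G t \<theta> x a * (?grad t x a \<bullet> r) + dir_deriv_left (\<lambda>\<eta>. G t \<eta> x a) \<theta> r))"
    if "t < T" "x \<in> X" for t x
    using that by (simp add: left_V left_G dV_step sum_negf[symmetric] algebra_simps)
  have left_max: "is_maximum_of (dir_deriv_left (\<lambda>\<eta>. G t \<eta> x a) \<theta> r)
      ((\<lambda>P. \<Sum>y\<in>X. pmf P y * dir_deriv_left (\<lambda>\<eta>. V (Suc t) \<eta> y) \<theta> r) ` Pstar t x a)"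
    if "t < T" "x \<in> X" "a \<in> A" for t x a
  proof -
    \<comment> \<open>\<open>Pstar\<close> does not depend on the direction, so the minimum for
      \<open>- r\<close> and the maximum for \<open>r\<close> range over the same laws.\<close>
    have "(\<Sum>y\<in>X. pmf P y * dir_deriv_left (\<lambda>\<eta>. V (Suc t) \<eta> y) \<theta> r)
        = - (\<Sum>y\<in>X. pmf P y * ?dV (- r) (Suc t) y)" for P
      using that by (simp add: left_V sum_negf[symmetric])
    then show ?thesis
      using dG(2)[OF that, of "- r"] by (auto simp: left_G[OF that] is_minimum_of_def is_maximum_of_def)
  qed
  show ?thesis
  proof (intro conjI allI ballI impI)
    fix t x assume *: "t \<le> T" "x \<in> X"
    show "dir_deriv_right_exists (\<lambda>\<eta>. V t \<eta> x) \<theta> r" using dV[OF *] by (rule dir_deriv_rightI(1))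
    show "dir_deriv_left_exists (\<lambda>\<eta>. V t \<eta> x) \<theta> r" using dV[OF *] by (rule dir_deriv_leftI(1))
  next
    fix x assume x: "x \<in> X"
    show "dir_deriv_right (\<lambda>\<eta>. V T \<eta> x) \<theta> r = 0" using x by (rule dV_T)
    show "dir_deriv_left (\<lambda>\<eta>. V T \<eta> x) \<theta> r = 0" using x by (simp add: left_V dV_T)
  next
    fix t x a assume *: "t < T" "x \<in> X" "a \<in> A"
    show "dir_deriv_right_exists (\<lambda>\<eta>. G t \<eta> x a) \<theta> r"
      using dG(1)[OF *] by (rule dir_deriv_rightI(1))
    show "dir_deriv_left_exists (\<lambda>\<eta>. G t \<eta> x a) \<theta> r"
      using dG(1)[OF *] by (rule dir_deriv_leftI(1))
    show "polytope (pmf ` Pstar t x a)"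
      unfolding Pstar_def by (rule polytope_worst_case_laws[OF fin(1) P0[OF *] q \<epsilon>])
    show "pmf ` Pstar t x a = second_marginal X ` transport_optimal q \<epsilon> X (P0 t x a) (H t x a)"
      unfolding Pstar_def by (rule pmf_image_worst_case_laws[OF fin(1) P0[OF *] q \<epsilon>])
  qed (use dV_step left_step dG(2) left_max in blast)+
qed

end
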